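(* Assume $\mathrm{MA}_{\aleph_1}$. Then $\mathbb{C}(\aleph_1)$ completely embeds into every complete c.c.c. Boolean algebra of uniform density $\aleph_1$.
   Context: $\mathrm{MA}_{\aleph_1}$ is Martin's Axiom for $\aleph_1$ many dense sets. For an infinite cardinal $\kappa$, $\mathbb{C}(\kappa)$ is the complete Boolean algebra of regular open subsets of $\{0,1\}^{\kappa}$; equivalently, $\mathbb{C}(\kappa)=RO(C_\kappa)$, the regular open algebra of the poset $C_\kappa$ of all finite partial functions from $\kappa$ to $2$ ordered by reverse inclusion. Embeddings of complete Boolean algebras are complete embeddings, i.e. isomorphisms onto a complete subalgebra. A poset $P$ has uniform density $\kappa$ if $|P|=\kappa$ and there are no $p\in P$ and $R\subset P$ with $|R|<\kappa$ such that $R$ is dense below $p$ (i.e. every $q\le p$ has some $r\in R$ with $r\le q$). A complete Boolean algebra has uniform density $\kappa$ if it has a dense subset (of its nonzero elements) which, as a poset, has uniform density $\kappa$. *)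

theory Defs
  imports "HOL-Analysis.Analysis"
begin

unbundle cardinal_syntax

section \<open>The cardinal \<open>\<aleph>\<^sub>1\<close>\<close>

abbreviation aleph1 :: "nat set rel" where
  "aleph1 \<equiv> cardSuc natLeq"

typedef omega1 = "Field aleph1"
proof -
  have "Field aleph1 \<noteq> {}"
    using Cinfinite_cardSuc[OF natLeq_Cinfinite] by (auto simp: cinfinite_def)
  then show ?thesis by blast
qed

lemma card_of_omega1: "|UNIV :: omega1 set| =o aleph1"
proof -
  have "bij_betw Rep_omega1 UNIV (Field aleph1)"
    using type_definition.Rep_range[OF type_definition_omega1]
      type_definition.Rep_inject[OF type_definition_omega1]
    by (auto simp: bij_betw_def inj_on_def)
  then have "|UNIV :: omega1 set| =o |Field aleph1|"
    using card_of_ordIso by blast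
  moreover have "|Field aleph1| =o aleph1"
    by (simp add: card_of_Field_ordIso cardSuc_Card_order natLeq_Card_order)
  ultimately show ?thesis by (rule ordIso_transitive)
qed


section \<open>Posets\<close>

text \<open>A poset consists of a carrier set \<open>P\<close> and a relation \<open>le\<close>; only the values of \<open>le\<close> on \<open>P\<close> matter.\<close>

definition poset_on :: "'p set \<Rightarrow> ('p \<Rightarrow> 'p \<Rightarrow> bool) \<Rightarrow> bool" where
  "poset_on P le \<longleftrightarrow> reflp_on P le \<and> transp_on P le \<and> antisymp_on P le"

definition dense_below :: "'p set \<Rightarrow> ('p \<Rightarrow> 'p \<Rightarrow> bool) \<Rightarrow> 'p \<Rightarrow> 'p set \<Rightarrow> bool" where
  "dense_below P le p R \<longleftrightarrow> (\<forall>q\<in>P. le q p \<longrightarrow> (\<exists>r\<in>R. le r q))"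

definition dense_in :: "'p set \<Rightarrow> ('p \<Rightarrow> 'p \<Rightarrow> bool) \<Rightarrow> 'p set \<Rightarrow> bool" where
  "dense_in P le D \<longleftrightarrow> D \<subseteq> P \<and> (\<forall>p\<in>P. \<exists>d\<in>D. le d p)"

definition compatible :: "'p set \<Rightarrow> ('p \<Rightarrow> 'p \<Rightarrow> bool) \<Rightarrow> 'p \<Rightarrow> 'p \<Rightarrow> bool" where
  "compatible P le p q \<longleftrightarrow> (\<exists>r\<in>P. le r p \<and> le r q)"

definition ccc_poset :: "'p set \<Rightarrow> ('p \<Rightarrow> 'p \<Rightarrow> bool) \<Rightarrow> bool" where
  "ccc_poset P le \<longleftrightarrow>
    (\<forall>A\<subseteq>P. pairwise (\<lambda>p q. \<not> compatible P le p q) A \<longrightarrow> countable A)"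

definition poset_filter :: "'p set \<Rightarrow> ('p \<Rightarrow> 'p \<Rightarrow> bool) \<Rightarrow> 'p set \<Rightarrow> bool" where
  "poset_filter P le G \<longleftrightarrow> G \<subseteq> P \<and> G \<noteq> {} \<and>
    (\<forall>p\<in>G. \<forall>q\<in>P. le p q \<longrightarrow> q \<in> G) \<and>
    (\<forall>p\<in>G. \<forall>q\<in>G. \<exists>r\<in>G. le r p \<and> le r q)"

definition poset_uniform_density :: "'p set \<Rightarrow> ('p \<Rightarrow> 'p \<Rightarrow> bool) \<Rightarrow> 'k rel \<Rightarrow> bool" where
  "poset_uniform_density P le \<kappa> \<longleftrightarrow> |P| =o \<kappa> \<and>
    \<not> (\<exists>p\<in>P. \<exists>R\<subseteq>P. |R| <o \<kappa> \<and> dense_below P le p R)"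


section \<open>Martin's Axiom\<close>

text \<open>
  HOL cannot quantify over all types, so the axiom is stated relative to a type \<open>'p\<close> from
  which the carriers of the posets are drawn. By a downward Loewenheim-Skolem argument any
  \<open>'p\<close> with at least \<open>\<kappa>\<close> elements gives the full axiom; for smaller types it may be weaker.
\<close>

definition MA :: "'k rel \<Rightarrow> 'p itself \<Rightarrow> bool" where
  "MA \<kappa> (_ :: 'p itself) \<longleftrightarrow>
    (\<forall>(P :: 'p set) le \<D>.
      poset_on P le \<and> P \<noteq> {} \<and> ccc_poset P le \<and> |\<D>| \<le>o \<kappa> \<and> (\<forall>D\<in>\<D>. dense_in P le D)
      \<longrightarrow> (\<exists>G. poset_filter P le G \<and> (\<forall>D\<in>\<D>. G \<inter> D \<noteq> {})))"


section \<open>Complete Boolean algebras\<close>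

text \<open>
  A complete Boolean algebra is a type of sort \<open>{complete_lattice, boolean_algebra}\<close>. The
  library class \<open>complete_boolean_algebra\<close> is not used: it demands complete distributivity,
  which forces atomicity.
\<close>

definition ccc_algebra :: "'b::{complete_lattice, boolean_algebra} itself \<Rightarrow> bool" where
  "ccc_algebra (_ :: 'b itself) \<longleftrightarrow>
    (\<forall>A :: 'b set. bot \<notin> A \<and> pairwise (\<lambda>x y. inf x y = bot) A \<longrightarrow> countable A)"

definition algebra_uniform_density ::
    "'b::{complete_lattice, boolean_algebra} itself \<Rightarrow> 'k rel \<Rightarrow> bool" where
  "algebra_uniform_density (_ :: 'b itself) \<kappa> \<longleftrightarrow>
    (\<exists>D :: 'b set. dense_in {b. b \<noteq> bot} (\<le>) D \<and> poset_uniform_density D (\<le>) \<kappa>)"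

definition complete_subalgebra :: "'b::{complete_lattice, boolean_algebra} set \<Rightarrow> bool" where
  "complete_subalgebra S \<longleftrightarrow>
    (\<forall>x\<in>S. - x \<in> S) \<and> (\<forall>X\<subseteq>S. Sup X \<in> S) \<and> (\<forall>X\<subseteq>S. Inf X \<in> S)"

definition boolean_hom :: "('a::boolean_algebra \<Rightarrow> 'b::boolean_algebra) \<Rightarrow> bool" where
  "boolean_hom f \<longleftrightarrow> f bot = bot \<and> f top = top \<and> (\<forall>x. f (- x) = - f x) \<and>
    (\<forall>x y. f (inf x y) = inf (f x) (f y)) \<and> (\<forall>x y. f (sup x y) = sup (f x) (f y))"

definition complete_embedding ::
    "('a::{complete_lattice, boolean_algebra} \<Rightarrow> 'b::{complete_lattice, boolean_algebra}) \<Rightarrow> bool"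
  where
  "complete_embedding f \<longleftrightarrow> boolean_hom f \<and> inj f \<and> complete_subalgebra (range f)"

text \<open>In particular such an embedding preserves all suprema, computed in the target algebra.\<close>

lemma complete_embedding_le_iff:
  assumes "complete_embedding f"
  shows "f x \<le> f y \<longleftrightarrow> x \<le> y"
proof -
  have "inj f" "f (inf x y) = inf (f x) (f y)"
    using assms by (auto simp: complete_embedding_def boolean_hom_def)
  then show ?thesis by (metis inj_eq le_iff_inf)
qed

lemma complete_embedding_Sup:
  assumes "complete_embedding f"
  shows "f (Sup X) = Sup (f ` X)"
proof (rule antisym)
  have "Sup (f ` X) \<in> range f"
    using assms unfolding complete_embedding_def complete_subalgebra_def
    by (meson image_mono subset_UNIV)
  then obtain z where z: "Sup (f ` X) = f z" by blast
  have "x \<le> z" if "x \<in> X" for x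
  proof -
    have "f x \<le> f z" unfolding z[symmetric] using that by (auto intro: Sup_upper)
    then show ?thesis using complete_embedding_le_iff[OF assms] by blast
  qed
  then have "Sup X \<le> z" by (rule Sup_least)
  then show "f (Sup X) \<le> Sup (f ` X)"
    unfolding z using complete_embedding_le_iff[OF assms] by blast
  show "Sup (f ` X) \<le> f (Sup X)"
    by (rule Sup_least) (auto simp: complete_embedding_le_iff[OF assms] intro: Sup_upper)
qed


section \<open>The regular open algebra of a topological space\<close>

typedef (overloaded) 'a regular_open =
  "{U :: 'a::topological_space set. interior (closure U) = U}"
  morphisms Rep_ro Abs_ro
  by (rule exI[of _ "{}"]) simp

setup_lifting type_definition_regular_open

lemma interior_closure_idem:
  "interior (closure (interior (closure U))) = interior (closure U)"
proof (rule antisym)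
  have "closure (interior (closure U)) \<subseteq> closure U"
    by (simp add: closure_minimal interior_subset)
  then show "interior (closure (interior (closure U))) \<subseteq> interior (closure U)"
    by (rule interior_mono)
  show "interior (closure U) \<subseteq> interior (closure (interior (closure U)))"
    by (simp add: closure_subset interior_maximal)
qed

lemma regular_open_Inter:
  assumes "\<And>U. U \<in> \<U> \<Longrightarrow> interior (closure U) = U"
  shows "interior (closure (interior (\<Inter>\<U>))) = interior (\<Inter>\<U>)"
proof (rule antisym)
  have "interior (closure (interior (\<Inter>\<U>))) \<subseteq> U" if "U \<in> \<U>" for U
  proof -
    have "interior (closure (interior (\<Inter>\<U>))) \<subseteq> interior (closure U)"
      using that by (intro interior_mono closure_mono) (auto dest: subsetD[OF interior_subset])
    then show ?thesis using assms[OF that] by simp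
  qed
  then show "interior (closure (interior (\<Inter>\<U>))) \<subseteq> interior (\<Inter>\<U>)"
    by (intro interior_maximal) auto
  show "interior (\<Inter>\<U>) \<subseteq> interior (closure (interior (\<Inter>\<U>)))"
    by (simp add: closure_subset interior_maximal)
qed

lemma regular_open_Int:
  assumes "interior (closure U) = U" "interior (closure V) = V"
  shows "interior (closure (U \<inter> V)) = U \<inter> V"
proof -
  have "open U" "open V" using assms by (metis open_interior)+
  then have "interior (\<Inter>{U, V}) = U \<inter> V" by (simp add: interior_open open_Int)
  then show ?thesis using regular_open_Inter[of "{U, V}"] assms by force
qed

instantiation regular_open :: (topological_space) "{complete_lattice, boolean_algebra}"
begin

lift_definition less_eq_regular_open :: "'a regular_open \<Rightarrow> 'a regular_open \<Rightarrow> bool"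
  is "(\<subseteq>)" .

lift_definition less_regular_open :: "'a regular_open \<Rightarrow> 'a regular_open \<Rightarrow> bool"
  is "(\<subset>)" .

lift_definition bot_regular_open :: "'a regular_open" is "{}" by simp

lift_definition top_regular_open :: "'a regular_open" is "UNIV" by simp

lift_definition inf_regular_open :: "'a regular_open \<Rightarrow> 'a regular_open \<Rightarrow> 'a regular_open"
  is "(\<inter>)" by (rule regular_open_Int)

lift_definition sup_regular_open :: "'a regular_open \<Rightarrow> 'a regular_open \<Rightarrow> 'a regular_open"
  is "\<lambda>U V. interior (closure (U \<union> V))" by (rule interior_closure_idem)

lift_definition Inf_regular_open :: "'a regular_open set \<Rightarrow> 'a regular_open"
  is "\<lambda>\<U>. interior (\<Inter>\<U>)" by (rule regular_open_Inter) blast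

lift_definition Sup_regular_open :: "'a regular_open set \<Rightarrow> 'a regular_open"
  is "\<lambda>\<U>. interior (closure (\<Union>\<U>))" by (rule interior_closure_idem)

lift_definition uminus_regular_open :: "'a regular_open \<Rightarrow> 'a regular_open"
  is "\<lambda>U. interior (- U)"
  by (metis closure_interior double_complement interior_closure_idem)

definition minus_regular_open :: "'a regular_open \<Rightarrow> 'a regular_open \<Rightarrow> 'a regular_open"
  where "minus_regular_open U V = inf U (- V)"

instance
proof
  fix x y z :: "'a regular_open" and A :: "'a regular_open set"
  show "(x < y) = (x \<le> y \<and> \<not> y \<le> x)" by transfer auto
  show "x \<le> x" by transfer auto
  show "x \<le> y \<Longrightarrow> y \<le> z \<Longrightarrow> x \<le> z" by transfer auto
  show "x \<le> y \<Longrightarrow> y \<le> x \<Longrightarrow> x = y" by transfer auto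
  show "inf x y \<le> x" "inf x y \<le> y" by (transfer, auto)+
  show "x \<le> y \<Longrightarrow> x \<le> z \<Longrightarrow> x \<le> inf y z" by transfer auto
  show "x \<le> sup x y" "y \<le> sup x y"
    by (transfer, metis closure_mono interior_mono sup_ge1 sup_ge2)+
  show "y \<le> x \<Longrightarrow> z \<le> x \<Longrightarrow> sup y z \<le> x"
    by transfer (metis closure_mono interior_mono sup_least)
  show "bot \<le> x" "x \<le> top" by (transfer, auto)+
  show "x \<in> A \<Longrightarrow> Inf A \<le> x" by transfer (meson Inter_lower interior_subset order_trans)
  show "(\<And>x. x \<in> A \<Longrightarrow> z \<le> x) \<Longrightarrow> z \<le> Inf A"
    by transfer (metis Inter_greatest interior_maximal open_interior)
  show "x \<in> A \<Longrightarrow> x \<le> Sup A"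
    by transfer (metis Union_upper closure_mono interior_mono)
  show "(\<And>x. x \<in> A \<Longrightarrow> x \<le> z) \<Longrightarrow> Sup A \<le> z"
    by transfer (metis Union_least closure_mono interior_mono)
  show "Inf {} = (top :: 'a regular_open)" by transfer simp
  show "Sup {} = (bot :: 'a regular_open)" by transfer simp
  show "inf x (- x) = bot" by transfer (use interior_subset in fastforce)
  show "sup x (- x) = top"
  proof transfer
    fix U :: "'a set"
    have "closure (U \<union> interior (- U)) = UNIV"
      using closure_subset[of "- closure U"] by (auto simp: closure_Un interior_complement)
    then show "interior (closure (U \<union> interior (- U))) = UNIV" by simp
  qed
  show "x - y = inf x (- y)" by (rule minus_regular_open_def)
  show "sup x (inf y z) = inf (sup x y) (sup x z)"
  proof transfer
    fix U V W :: "'a set"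
    assume reg: "interior (closure U) = U" "interior (closure V) = V" "interior (closure W) = W"
    then have op: "open U" "open V" "open W" by (metis open_interior)+
    let ?L = "interior (closure (U \<union> V \<inter> W))"
    let ?R = "interior (closure (U \<union> V)) \<inter> interior (closure (U \<union> W))"
    have "?R \<subseteq> closure (U \<union> V \<inter> W)"
    proof
      fix p assume p: "p \<in> ?R"
      show "p \<in> closure (U \<union> V \<inter> W)"
        unfolding closure_iff_nhds_not_empty
      proof (intro allI impI)
        fix N S assume N: "S \<subseteq> N" "open S" "p \<in> S"
        let ?S1 = "S \<inter> ?R"
        have S1: "open ?S1" "p \<in> ?S1" using N p by auto
        have "p \<in> closure (U \<union> V)" using p interior_subset by blast
        then have "(U \<union> V) \<inter> ?S1 \<noteq> {}" using S1 closure_iff_nhds_not_empty by blast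
        moreover have "(V \<inter> ?S1) \<inter> (U \<union> W) \<noteq> {}" if q: "V \<inter> ?S1 \<noteq> {}"
        proof -
          obtain q where q: "q \<in> V \<inter> ?S1" using q by blast
          then have "q \<in> closure (U \<union> W)" using interior_subset by blast
          then show ?thesis
            using q S1(1) op(2) closure_iff_nhds_not_empty open_Int by (metis inf_commute order_refl)
        qed
        ultimately show "(U \<union> V \<inter> W) \<inter> N \<noteq> {}" using N by blast
      qed
    qed
    then have "?R \<subseteq> ?L" by (intro interior_maximal) auto
    moreover have "?L \<subseteq> ?R" by (intro Int_greatest interior_mono closure_mono) auto
    ultimately show "?L = ?R" by blast
  qed
qed

end

text \<open>
  The algebra \<open>\<C>(\<kappa>)\<close> for an index type \<open>'k\<close> of cardinality \<open>\<kappa>\<close>, where \<open>'k \<Rightarrow> bool\<close> carries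
  the product of the discrete topologies.
\<close>

type_synonym 'k cohen_algebra = "('k \<Rightarrow> bool) regular_open"

end

theory Submission
  imports Defs
begin

text \<open>
  Fix a dense set \<open>D\<close> of size \<open>\<aleph>\<^sub>1\<close> witnessing uniform density. Since \<open>MA\<close> makes finite powers of \<open>D\<close>
  ccc and \<open>D\<close> itself \<open>\<sigma>\<close>-centred, the algebra adds a real. By recursion one chooses countable ideals
  \<open>I \<alpha>\<close>, \<open>\<alpha> < \<omega>\<^sub>1\<close>, each rich enough to split any element in small pieces, but such that no
  member of \<open>D\<close> enumerated before stage \<open>\<gamma>\<close> is covered by finitely many elements of the later ideals;
  uniform density is what keeps this recursion going. A poset of finite approximations then adds a
  sequence \<open>\<beta> \<alpha>\<close> of elements, built from pieces in \<open>I \<alpha>\<close>, together with promises that elements of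
  a dense set are independent of all but finitely many of the \<open>\<beta> \<alpha>\<close>. For the ccc, two conditions with
  the same root clash only if one is covered by pieces of the other; a long family of such coverings
  would, by the ccc of the powers of \<open>D\<close>, yield one element covered by pieces from uncountably many
  stages. A filter from \<open>MA\<close> gives \<open>\<beta>\<close>, and basic clopen sets map to finite meets of the \<open>\<beta> \<alpha>\<close>.
\<close>

section \<open>The cardinal \<open>\<aleph>\<^sub>1\<close>\<close>

text \<open>What makes the embedding complete is that every nonzero \<open>p\<close> has a
  reduction: a nonzero \<open>r\<close> below \<open>p\<close> that decides finitely many
  coordinates and is compatible with every finite assignment to the others. Finite approximations
  alone do not ensure this, since later pieces could swallow \<open>p\<close>; the promises prevent
  it, but they endanger the ccc. The ideals reconcile the two demands. Pieces are small so that
  finitely many promises survive the decision of one more coordinate. The ideals are countable so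
  that uncountably many conditions can be made to agree on a finite set of coordinates. That later
  pieces never cover an earlier member of \<open>D\<close> lets all but countably many conditions of
  a thinned family spare a given element off the root. The real enters as a countable family that
  splits every nonzero element: halving along it yields arbitrarily small pieces inside a countable
  algebra.\<close>

abbreviation small :: "'a set \<Rightarrow> bool" where
  "small X \<equiv> |X| \<le>o aleph1"

lemma small_iff_omega1: "small X \<longleftrightarrow> |X| \<le>o |UNIV :: omega1 set|"
  by (meson card_of_omega1 ordLeq_ordIso_trans ordIso_symmetric)

lemma natLeq_less_aleph1: "natLeq <o aleph1"
  by (simp add: cardSuc_greater natLeq_Card_order)

lemma uncountable_omega1: "uncountable (UNIV :: omega1 set)"
proof
  assume "countable (UNIV :: omega1 set)"
  then have "|UNIV :: omega1 set| \<le>o natLeq"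
    by (meson card_of_nat countable_def card_of_ordLeq ordLeq_ordIso_trans subset_UNIV)
  then have "aleph1 \<le>o natLeq"
    using card_of_omega1 ordIso_ordLeq_trans ordIso_symmetric by blast
  then show False using natLeq_less_aleph1 not_ordLess_ordLeq by blast
qed

lemma infinite_omega1: "infinite (UNIV :: omega1 set)"
  using uncountable_omega1 uncountable_infinite by blast

lemma ordLess_aleph1_imp_countable:
  assumes "|X| <o aleph1"
  shows "countable X"
proof -
  have "|X| \<le>o natLeq"
    using assms cardSuc_ordLeq_ordLess[OF natLeq_Card_order card_of_Card_order] by blast
  then have "|X| \<le>o |UNIV :: nat set|"
    using card_of_nat ordLeq_ordIso_trans ordIso_symmetric by blast
  then show ?thesis unfolding card_of_ordLeq[symmetric] countable_def by blast
qed

lemma countable_imp_ordLess_aleph1: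
  assumes "countable X"
  shows "|X| <o aleph1"
proof -
  have "|X| \<le>o natLeq"
    using assms by (meson card_of_nat countable_def card_of_ordLeq ordLeq_ordIso_trans subset_UNIV)
  then show ?thesis using natLeq_less_aleph1 ordLeq_ordLess_trans by blast
qed

lemma small_countable: "countable X \<Longrightarrow> small X"
  using countable_imp_ordLess_aleph1 ordLess_imp_ordLeq by blast

lemma small_subset: "X \<subseteq> Y \<Longrightarrow> small Y \<Longrightarrow> small X"
  using card_of_mono1 ordLeq_transitive by blast

lemma small_image: "small X \<Longrightarrow> small (f ` X)"
  using card_of_image ordLeq_transitive by blast

lemma small_UN: "small I \<Longrightarrow> (\<And>i. i \<in> I \<Longrightarrow> small (A i)) \<Longrightarrow> small (\<Union>i\<in>I. A i)"
  unfolding small_iff_omega1 using card_of_UNION_ordLeq_infinite[OF infinite_omega1] by blast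

lemma small_Times: "small X \<Longrightarrow> small Y \<Longrightarrow> small (X \<times> Y)"
  unfolding small_iff_omega1
  by (rule card_of_Times_ordLeq_infinite_Field)
    (use infinite_omega1 card_of_Card_order in \<open>simp_all only: Field_card_of not_False_eq_True\<close>)

lemma small_omega1: "small (X :: omega1 set)"
  unfolding small_iff_omega1 by (simp add: card_of_mono1)

lemma small_lists:
  assumes "small X"
  shows "small (lists X)"
proof -
  have len: "small {xs \<in> lists X. length xs = n}" for n
  proof (induction n)
    case 0
    have "{xs \<in> lists X. length xs = 0} = {[]}" by auto
    then show ?case by (simp only:) (rule small_countable, simp)
  next
    case (Suc n)
    have "{xs \<in> lists X. length xs = Suc n} =
        (\<lambda>(x, xs). x # xs) ` (X \<times> {xs \<in> lists X. length xs = n})"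
      by (auto simp: length_Suc_conv)
    then show ?case by (simp only:) (intro small_image small_Times assms Suc.IH)
  qed
  have "lists X = (\<Union>n. {xs \<in> lists X. length xs = n})" by auto
  moreover have "small (\<Union>n. {xs \<in> lists X. length xs = n})"
    by (rule small_UN[OF small_countable[OF countableI_type] len])
  ultimately show ?thesis by (simp only:)
qed

lemma small_Fpow:
  assumes "small X"
  shows "small (Fpow X)"
proof -
  have "Fpow X \<subseteq> set ` lists X"
    using Collect_finite_subset_eq_lists[of X] by (auto simp: Fpow_def)
  then show ?thesis using small_subset small_image[OF small_lists[OF assms]] by blast
qed

lemma small_ex_enumeration:
  assumes "small X" "X \<noteq> {}"
  obtains g :: "omega1 \<Rightarrow> 'a" where "range g = X"
  using assms card_of_ordLeq2[of X "UNIV :: omega1 set"] unfolding small_iff_omega1 by blast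

lemma uncountable_ex_inj:
  assumes "uncountable S"
  obtains g :: "omega1 \<Rightarrow> 'a" where "inj g" "range g \<subseteq> S"
proof -
  have "\<not> |S| <o aleph1" using assms ordLess_aleph1_imp_countable by blast
  then have "aleph1 \<le>o |S|"
    by (metis card_of_Well_order cardSuc_Well_order natLeq_Card_order not_ordLess_iff_ordLeq)
  then have "|UNIV :: omega1 set| \<le>o |S|" using card_of_omega1 ordIso_ordLeq_trans by blast
  then show ?thesis using that unfolding card_of_ordLeq[symmetric] by blast
qed

section \<open>The well-order of the first uncountable ordinal\<close>

instantiation omega1 :: wellorder
begin

text \<open>The order is the one underlying the cardinal \<open>|UNIV|\<close>. Being of initial
  type it has only countable proper initial segments, which an arbitrary well-order of the type need
  not have.\<close>

definition less_eq_omega1 :: "omega1 \<Rightarrow> omega1 \<Rightarrow> bool" where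
  "\<alpha> \<le> \<beta> \<longleftrightarrow> (\<alpha>, \<beta>) \<in> |UNIV :: omega1 set|"

definition less_omega1 :: "omega1 \<Rightarrow> omega1 \<Rightarrow> bool" where
  "\<alpha> < \<beta> \<longleftrightarrow> (\<alpha>, \<beta>) \<in> |UNIV :: omega1 set| - Id"

instance
proof
  have wo: "well_order_on UNIV |UNIV :: omega1 set|"
    using card_of_Well_order[of "UNIV :: omega1 set"] by (simp add: Field_card_of)
  then have lin: "refl |UNIV :: omega1 set|" "trans |UNIV :: omega1 set|"
      "antisym |UNIV :: omega1 set|" "total |UNIV :: omega1 set|"
      "wf ( |UNIV :: omega1 set| - Id)"
    unfolding well_order_on_def linear_order_on_def partial_order_on_def preorder_on_def by auto
  fix x y z :: omega1 and P
  show "x \<le> x" using lin(1) by (simp add: less_eq_omega1_def refl_on_def)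
  show "x \<le> y \<Longrightarrow> y \<le> z \<Longrightarrow> x \<le> z"
    using lin(2) unfolding less_eq_omega1_def trans_def by blast
  show "x \<le> y \<Longrightarrow> y \<le> x \<Longrightarrow> x = y"
    using lin(3) unfolding less_eq_omega1_def antisym_def by blast
  show "x \<le> y \<or> y \<le> x"
    using lin(1,4) unfolding less_eq_omega1_def total_on_def refl_on_def by (cases "x = y") auto
  show "(x < y) = (x \<le> y \<and> \<not> y \<le> x)"
    using lin(3) unfolding less_eq_omega1_def less_omega1_def antisym_def by blast
  show "P x" if "\<And>x. (\<And>y. y < x \<Longrightarrow> P y) \<Longrightarrow> P x"
    using lin(5) that unfolding less_omega1_def by (rule wf_induct_rule) blast
qed

end

lemma countable_atMost_omega1: "countable {..\<alpha> :: omega1}"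
proof -
  have "underS |UNIV :: omega1 set| \<alpha> = {..<\<alpha>}"
    by (auto simp: underS_def less_omega1_def)
  moreover have "|underS |UNIV :: omega1 set| \<alpha>| <o |UNIV :: omega1 set|"
    by (rule card_of_underS) (use card_of_Card_order in \<open>simp_all only: Field_card_of UNIV_I\<close>)
  ultimately have "|{..<\<alpha>}| <o aleph1"
    using card_of_omega1 ordLess_ordIso_trans by metis
  then have "countable {..<\<alpha>}" by (rule ordLess_aleph1_imp_countable)
  moreover have "{..\<alpha>} = insert \<alpha> {..<\<alpha>}" by auto
  ultimately show ?thesis by simp
qed

lemma uncountable_greater_omega1:
  assumes "uncountable (S :: omega1 set)"
  obtains \<beta> where "\<beta> \<in> S" "\<alpha> < \<beta>"
proof -
  have "\<not> S \<subseteq> {..\<alpha>}" using assms countable_atMost_omega1 countable_subset by blast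
  then show ?thesis using that by (meson atMost_iff not_le subsetI)
qed

lemma uncountable_fibre:
  assumes "uncountable S" "countable (f ` S)"
  shows "\<exists>y. uncountable {c \<in> S. f c = y}"
proof (rule ccontr)
  assume no: "\<nexists>y. uncountable {c \<in> S. f c = y}"
  have "countable {c \<in> S. f c = y}" for y using no by blast
  then have "countable (\<Union>y\<in>f ` S. {c \<in> S. f c = y})" by (rule countable_UN[OF assms(2)])
  moreover have "S \<subseteq> (\<Union>y\<in>f ` S. {c \<in> S. f c = y})" by blast
  ultimately show False using assms(1) countable_subset by blast
qed

text \<open>A weak \<open>\<Delta>\<close>-system: the root \<open>w\<close> is a finite set of maximal size that is contained in
  uncountably many of the supports.\<close>

lemma ex_root:
  fixes supp :: "'c \<Rightarrow> 'd set"
  assumes S: "uncountable S" and fin: "\<forall>c\<in>S. finite (supp c)"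
  shows "\<exists>T w. T \<subseteq> S \<and> uncountable T \<and> finite w \<and> (\<forall>\<alpha>. \<alpha> \<notin> w \<longrightarrow> countable {c \<in> T. \<alpha> \<in> supp c})"
proof -
  \<comment> \<open>A common size \<open>n\<close> bounds every set contained in a support, so a
    root of maximal size exists.\<close>
  have "countable ((\<lambda>c. card (supp c)) ` S)" by simp
  then obtain n where n: "uncountable {c \<in> S. card (supp c) = n}"
    using uncountable_fibre[OF S] by blast
  define S' where "S' = {c \<in> S. card (supp c) = n}"
  let ?P = "\<lambda>w. finite w \<and> uncountable {c \<in> S'. w \<subseteq> supp c}"
  have bound: "card w \<le> n" if "?P w" for w
  proof -
    have "{c \<in> S'. w \<subseteq> supp c} \<noteq> {}" using that by (metis countable_empty)
    then obtain c where "c \<in> S'" "w \<subseteq> supp c" by blast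
    then show ?thesis using card_mono[of "supp c" w] fin by (auto simp: S'_def)
  qed
  have "?P {}" using n by (simp add: S'_def)
  then obtain w where w: "?P w" and max: "\<forall>w'. ?P w' \<longrightarrow> card w' \<le> card w"
    using ex_has_greatest_nat[of ?P "{}" card "Suc n"] bound by (auto simp: less_Suc_eq_le)
  have "countable {c \<in> {c \<in> S'. w \<subseteq> supp c}. \<alpha> \<in> supp c}" if "\<alpha> \<notin> w" for \<alpha>
  proof (rule ccontr)
    assume "uncountable {c \<in> {c \<in> S'. w \<subseteq> supp c}. \<alpha> \<in> supp c}"
    moreover have "{c \<in> {c \<in> S'. w \<subseteq> supp c}. \<alpha> \<in> supp c} = {c \<in> S'. insert \<alpha> w \<subseteq> supp c}" by auto
    ultimately have "card (insert \<alpha> w) \<le> card w" using max w by auto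
    then show False using w that by simp
  qed
  moreover have "{c \<in> S'. w \<subseteq> supp c} \<subseteq> S" by (auto simp: S'_def)
  ultimately show ?thesis using w by blast
qed

section \<open>Martin's Axiom and products\<close>

text \<open>Two adjustments to \<open>MA\<close>. Its posets live on the type \<open>'p\<close>, so
  \<open>P\<close> is copied there along an injection, which exists by cardinality. Its filter need
  not contain a prescribed condition, so it is applied to the cone below
  \<open>p\<^sub>0\<close>.\<close>

lemma MA_generic:
  fixes P :: "'q set" and le :: "'q \<Rightarrow> 'q \<Rightarrow> bool"
  assumes universe: "aleph1 \<le>o |UNIV :: 'p set|" and MA: "MA aleph1 TYPE('p)"
    and po: "poset_on P le" and ccc: "ccc_poset P le" and sm: "small P"
    and p0: "p\<^sub>0 \<in> P" and sm\<D>: "small \<D>" and dense: "\<forall>D\<in>\<D>. dense_in P le D"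
  shows "\<exists>G\<subseteq>P. p\<^sub>0 \<in> G \<and> (\<forall>p\<in>G. \<forall>q\<in>G. \<exists>r\<in>G. le r p \<and> le r q) \<and> (\<forall>D\<in>\<D>. G \<inter> D \<noteq> {})"
proof -
  have refl: "le p p" if "p \<in> P" for p
    using po that by (auto simp: poset_on_def reflp_on_def)
  have trans: "le p r" if "le p q" "le q r" "p \<in> P" "q \<in> P" "r \<in> P" for p q r
    using po that unfolding poset_on_def transp_on_def by blast
  have anti: "p = q" if "le p q" "le q p" "p \<in> P" "q \<in> P" for p q
    using po that unfolding poset_on_def antisymp_on_def by blast
  obtain f :: "'q \<Rightarrow> 'p" where f: "inj_on f P"
    using ordLeq_transitive[OF sm universe] unfolding card_of_ordLeq[symmetric] by blast
  define g where "g = the_inv_into P f"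
  have gf: "g (f p) = p" if "p \<in> P" for p
    using f that by (simp add: g_def the_inv_into_f_f)
  define P0 where "P0 = {p \<in> P. le p p\<^sub>0}"
  define le' where "le' = (\<lambda>x y. le (g x) (g y))"
  have po': "poset_on (f ` P0) le'"
    unfolding poset_on_def reflp_on_def transp_on_def antisymp_on_def le'_def P0_def
    by (auto simp: gf intro: refl) (metis trans, metis anti)
  have ccc': "ccc_poset (f ` P0) le'"
    unfolding ccc_poset_def
  proof (intro allI impI)
    fix A assume A: "A \<subseteq> f ` P0"
      and pw: "pairwise (\<lambda>p q. \<not> compatible (f ` P0) le' p q) A"
    have sub: "g ` A \<subseteq> P" using A by (auto simp: gf P0_def)
    have "pairwise (\<lambda>p q. \<not> compatible P le p q) (g ` A)"
    proof (rule pairwiseI)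
      fix p q assume pq: "p \<in> g ` A" "q \<in> g ` A" "p \<noteq> q"
      then have fp: "f p \<in> A" "f q \<in> A" "p \<in> P0" "q \<in> P0" using A by (auto simp: gf P0_def)
      have "f p \<noteq> f q" using fp pq(3) f by (auto simp: inj_on_def P0_def)
      then have nc: "\<not> compatible (f ` P0) le' (f p) (f q)"
        using pw fp unfolding pairwise_def by blast
      \<comment> \<open>A common extension of two members of the cone is again in the cone, so an
        antichain of the cone is one of \<open>P\<close>.\<close>
      show "\<not> compatible P le p q"
      proof
        assume "compatible P le p q"
        then obtain r where r: "r \<in> P" "le r p" "le r q" by (auto simp: compatible_def)
        then have "r \<in> P0" using fp p0 trans[of r p p\<^sub>0] by (auto simp: P0_def)
        then show False using nc r fp unfolding compatible_def le'_def
          by (auto simp: gf P0_def)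
      qed
    qed
    then have "countable (g ` A)" using ccc sub unfolding ccc_poset_def by blast
    moreover have "A \<subseteq> f ` (g ` A)"
    proof
      fix x assume x: "x \<in> A"
      then have "x = f (g x)" using A by (auto simp: gf P0_def)
      then show "x \<in> f ` (g ` A)" using x by blast
    qed
    ultimately show "countable A" by (meson countable_subset countable_image)
  qed
  have dense': "dense_in (f ` P0) le' (f ` (D \<inter> P0))" if D: "D \<in> \<D>" for D
    unfolding dense_in_def
  proof (intro conjI ballI)
    fix x assume "x \<in> f ` P0"
    then obtain p where p: "x = f p" "p \<in> P0" by blast
    then obtain d where d: "d \<in> D" "le d p" "d \<in> P"
      using dense D unfolding dense_in_def P0_def by blast
    then have "d \<in> P0" using p p0 trans[of d p p\<^sub>0] by (auto simp: P0_def)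
    then show "\<exists>d\<in>f ` (D \<inter> P0). le' d x"
      using d p by (intro bexI[of _ "f d"]) (auto simp: le'_def gf P0_def)
  qed auto
  have p0': "p\<^sub>0 \<in> P0" using p0 refl by (simp add: P0_def)
  define \<E> where "\<E> = (\<lambda>D. f ` (D \<inter> P0)) ` \<D>"
  have "small \<E>" unfolding \<E>_def using sm\<D> by (rule small_image)
  then obtain H where H: "poset_filter (f ` P0) le' H" "\<And>E. E \<in> \<E> \<Longrightarrow> H \<inter> E \<noteq> {}"
  proof -
    have "\<forall>E\<in>\<E>. dense_in (f ` P0) le' E" using dense' by (auto simp: \<E>_def)
    then have "\<exists>H. poset_filter (f ` P0) le' H \<and> (\<forall>E\<in>\<E>. H \<inter> E \<noteq> {})"
      using MA[unfolded MA_def, rule_format, of "f ` P0" le' \<E>] po' ccc' p0' \<open>small \<E>\<close> by blast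
    then show ?thesis using that by blast
  qed
  have "H \<noteq> {}" and HP: "H \<subseteq> f ` P0" and
    up: "\<And>x y. x \<in> H \<Longrightarrow> y \<in> f ` P0 \<Longrightarrow> le' x y \<Longrightarrow> y \<in> H" and
    dir: "\<And>x y. x \<in> H \<Longrightarrow> y \<in> H \<Longrightarrow> \<exists>z\<in>H. le' z x \<and> le' z y"
    using H(1) unfolding poset_filter_def by blast+
  obtain x where x: "x \<in> H" using \<open>H \<noteq> {}\<close> by blast
  have "le' x (f p\<^sub>0)" using x HP p0' by (auto simp: le'_def gf P0_def)
  then have "f p\<^sub>0 \<in> H" using up[OF x] p0' by blast
  show ?thesis
  proof (intro exI conjI ballI)
    show "p\<^sub>0 \<in> g ` H" using \<open>f p\<^sub>0 \<in> H\<close> gf[OF p0] by force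
    show "g ` H \<subseteq> P" using HP by (auto simp: gf P0_def)
    show "\<exists>r\<in>g ` H. le r p \<and> le r q" if "p \<in> g ` H" "q \<in> g ` H" for p q
      using that dir unfolding le'_def by blast
    show "g ` H \<inter> D \<noteq> {}" if "D \<in> \<D>" for D
    proof -
      have "f ` (D \<inter> P0) \<in> \<E>" using that by (simp add: \<E>_def)
      then obtain p where "p \<in> D" "p \<in> P0" "f p \<in> H" using H(2) by blast
      moreover have "p \<in> g ` H" using calculation gf[of p] by (force simp: P0_def)
      ultimately show ?thesis by blast
    qed
  qed
qed

section \<open>Maximal antichains and the Knaster property\<close>

lemma chain_imp_chain_subset: "subset.chain \<A> \<C> \<Longrightarrow> chain\<^sub>\<subseteq> \<C>"
  unfolding subset.chain_def chain_subset_def by fast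

text \<open>Stated for an arbitrary relation because it serves both the compatibility of a poset and
  nonzero meets in an algebra.\<close>

lemma ex_maximal_antichain:
  assumes "\<And>x. x \<in> K \<Longrightarrow> R x x" "\<And>x y. R x y \<Longrightarrow> R y x"
  obtains W where "W \<subseteq> K" "pairwise (\<lambda>x y. \<not> R x y) W" "\<And>x. x \<in> K \<Longrightarrow> \<exists>w\<in>W. R x w"
proof -
  let ?\<A> = "{W. W \<subseteq> K \<and> pairwise (\<lambda>x y. \<not> R x y) W}"
  have "\<exists>M\<in>?\<A>. \<forall>X\<in>?\<A>. M \<subseteq> X \<longrightarrow> X = M"
  proof (rule subset_Zorn_nonempty)
    show "\<Union>\<C> \<in> ?\<A>" if "\<C> \<noteq> {}" "subset.chain ?\<A> \<C>" for \<C>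
    proof -
      have "pairwise (\<lambda>x y. \<not> R x y) (\<Union>\<C>)"
        using that(2) by (intro pairwise_chain_Union[OF _ chain_imp_chain_subset])
          (auto simp: subset.chain_def)
      then show ?thesis using that by (auto simp: subset.chain_def)
    qed
  qed auto
  then obtain W where W: "W \<in> ?\<A>" and max: "\<forall>X\<in>?\<A>. W \<subseteq> X \<longrightarrow> X = W" ..
  show ?thesis
  proof (rule that)
    show "W \<subseteq> K" "pairwise (\<lambda>x y. \<not> R x y) W" using W by auto
    fix x assume x: "x \<in> K"
    show "\<exists>w\<in>W. R x w"
    proof (rule ccontr)
      assume no: "\<not> (\<exists>w\<in>W. R x w)"
      then have "insert x W \<in> ?\<A>" using W x assms(2) by (auto simp: pairwise_insert)
      then have "insert x W = W" using max by (metis subset_insertI)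
      then show False using no x assms(1) by blast
    qed
  qed
qed

text \<open>\<open>p\<close> forces uncountably many \<open>a \<xi>\<close> into the generic filter.
  Otherwise the conditions compatible with only countably many of them are dense, and a maximal
  antichain \<open>W\<close> of such conditions, being countable, misses some \<open>a \<xi>\<close>
  altogether; but below that \<open>a \<xi>\<close> there is again such a condition, which must meet
  \<open>W\<close>.\<close>

lemma ccc_poset_often_compatible:
  assumes po: "poset_on P le" and ccc: "ccc_poset P le"
    and a: "\<And>\<xi>. \<xi> \<in> S \<Longrightarrow> a \<xi> \<in> P" and S: "uncountable S"
  shows "\<exists>p\<in>P. \<forall>q\<in>P. le q p \<longrightarrow> uncountable {\<xi> \<in> S. compatible P le q (a \<xi>)}"
proof (rule ccontr)
  assume no: "\<not> ?thesis"
  have refl: "le p p" if "p \<in> P" for p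
    using po that by (auto simp: poset_on_def reflp_on_def)
  let ?K = "{q \<in> P. countable {\<xi> \<in> S. compatible P le q (a \<xi>)}}"
  obtain W where W: "W \<subseteq> ?K" "pairwise (\<lambda>x y. \<not> compatible P le x y) W"
      "\<And>x. x \<in> ?K \<Longrightarrow> \<exists>w\<in>W. compatible P le x w"
    by (rule ex_maximal_antichain[of ?K "compatible P le"])
      (auto simp: compatible_def intro: refl)
  have "countable W" using ccc W(1,2) unfolding ccc_poset_def by blast
  then have "countable (\<Union>w\<in>W. {\<xi> \<in> S. compatible P le w (a \<xi>)})" using W(1) by blast
  then obtain \<xi> where \<xi>: "\<xi> \<in> S" "\<And>w. w \<in> W \<Longrightarrow> \<not> compatible P le w (a \<xi>)"
    using S countable_subset[of S "\<Union>w\<in>W. {\<xi> \<in> S. compatible P le w (a \<xi>)}"] by fastforce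
  obtain q where q: "q \<in> ?K" "le q (a \<xi>)" using no a[OF \<xi>(1)] by blast
  obtain w where w: "w \<in> W" "compatible P le q w" using W(3)[OF q(1)] by blast
  then obtain r where r: "r \<in> P" "le r q" "le r w" by (auto simp: compatible_def)
  have "le r (a \<xi>)"
  proof (rule transp_onD[of P le r q])
    show "transp_on P le" using po by (simp add: poset_on_def)
  qed (use r q a[OF \<xi>(1)] in auto)
  then show False using \<xi>(2)[OF w(1)] r unfolding compatible_def by blast
qed

text \<open>Meeting \<open>E \<zeta>\<close> for every \<open>\<zeta>\<close> makes the set of
  indices whose \<open>a\<close> lies above a member of \<open>G\<close> unbounded in
  \<open>omega1\<close>, hence uncountable; directedness of \<open>G\<close> gives the
  compatibility.\<close>

lemma MA_precaliber:
  fixes P :: "'q set"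
  assumes universe: "aleph1 \<le>o |UNIV :: 'p set|" and MA: "MA aleph1 TYPE('p)"
    and po: "poset_on P le" and ccc: "ccc_poset P le" and sm: "small P"
    and a: "\<And>\<xi>. \<xi> \<in> S \<Longrightarrow> a \<xi> \<in> P" and S: "uncountable S"
  obtains S' where "S' \<subseteq> S" "uncountable S'"
    "\<And>\<xi> \<eta>. \<xi> \<in> S' \<Longrightarrow> \<eta> \<in> S' \<Longrightarrow> compatible P le (a \<xi>) (a \<eta>)"
proof -
  obtain g :: "omega1 \<Rightarrow> 'a" where g: "inj g" "range g \<subseteq> S" by (rule uncountable_ex_inj[OF S])
  have ag: "a (g \<xi>) \<in> P" for \<xi> using a g by blast
  obtain p\<^sub>0 where p0: "p\<^sub>0 \<in> P"
      "\<And>q. q \<in> P \<Longrightarrow> le q p\<^sub>0 \<Longrightarrow> uncountable {\<xi> \<in> UNIV. compatible P le q (a (g \<xi>))}"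
    using ccc_poset_often_compatible[OF po ccc, of UNIV "\<lambda>\<xi>. a (g \<xi>)", OF ag uncountable_omega1]
    by blast
  \<comment> \<open>Only below \<open>p\<^sub>0\<close> are large indices guaranteed. The conditions
    incompatible with \<open>p\<^sub>0\<close> are added to make \<open>E \<zeta>\<close> dense
    everywhere; a filter through \<open>p\<^sub>0\<close> contains none of them.\<close>
  define E where "E \<zeta> = {q \<in> P. \<not> compatible P le q p\<^sub>0 \<or> (\<exists>\<xi>>\<zeta>. le q (a (g \<xi>)))}" for \<zeta>
  have refl: "le p p" if "p \<in> P" for p
    using po that by (auto simp: poset_on_def reflp_on_def)
  have trans: "le p r" if "le p q" "le q r" "p \<in> P" "q \<in> P" "r \<in> P" for p q r
    using po that unfolding poset_on_def transp_on_def by blast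
  have E: "dense_in P le (E \<zeta>)" for \<zeta>
    unfolding dense_in_def
  proof (intro conjI ballI)
    show "E \<zeta> \<subseteq> P" by (auto simp: E_def)
    fix p assume p: "p \<in> P"
    show "\<exists>d\<in>E \<zeta>. le d p"
    proof (cases "compatible P le p p\<^sub>0")
      case True
      then obtain q where q: "q \<in> P" "le q p" "le q p\<^sub>0" by (auto simp: compatible_def)
      from uncountable_greater_omega1[OF p0(2)[OF q(1,3)]]
      obtain \<xi> where \<xi>: "\<zeta> < \<xi>" "compatible P le q (a (g \<xi>))" by blast
      then obtain r where r: "r \<in> P" "le r q" "le r (a (g \<xi>))" by (auto simp: compatible_def)
      then have "r \<in> E \<zeta>" using \<xi> by (auto simp: E_def)
      then show ?thesis using trans[OF r(2) q(2) r(1) q(1) p] by blast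
    next
      case False
      then show ?thesis using p refl[OF p] by (intro bexI[of _ p]) (auto simp: E_def)
    qed
  qed
  then have "\<forall>D\<in>range E. dense_in P le D" by blast
  then obtain G where G: "G \<subseteq> P" "p\<^sub>0 \<in> G" "\<forall>p\<in>G. \<forall>q\<in>G. \<exists>r\<in>G. le r p \<and> le r q"
      "\<forall>D\<in>range E. G \<inter> D \<noteq> {}"
    using MA_generic[OF universe MA po ccc sm p0(1) small_image[OF small_omega1, of E UNIV]] by blast
  define T where "T = {\<xi>. \<exists>p\<in>G. le p (a (g \<xi>))}"
  have "\<exists>\<xi>\<in>T. \<zeta> < \<xi>" for \<zeta>
  proof -
    obtain p where "p \<in> G" "p \<in> E \<zeta>" using G(4) by blast
    moreover have "compatible P le p p\<^sub>0"
      using calculation(1) G(1-3) unfolding compatible_def by blast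
    ultimately show ?thesis by (auto simp: E_def T_def)
  qed
  then have unc: "uncountable T"
  proof (rule_tac notI)
    assume cT: "countable T" and unb: "\<And>\<zeta>. \<exists>\<xi>\<in>T. \<zeta> < \<xi>"
    have "(UNIV :: omega1 set) = (\<Union>\<xi>\<in>T. {..\<xi>})"
      using unb by (auto simp: set_eq_iff) (meson less_imp_le)
    moreover have "countable (\<Union>\<xi>\<in>T. {..\<xi>})" using cT countable_atMost_omega1 by blast
    ultimately show False using uncountable_omega1 by simp
  qed
  show ?thesis
  proof
    show "g ` T \<subseteq> S" using g by blast
    show "uncountable (g ` T)" using unc g(1) countable_image_inj_on inj_on_subset by blast
    fix \<xi> \<eta> assume "\<xi> \<in> g ` T" "\<eta> \<in> g ` T"
    then obtain p q where pq: "p \<in> G" "q \<in> G" "le p (a \<xi>)" "le q (a \<eta>)" "a \<xi> \<in> P" "a \<eta> \<in> P"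
      using ag by (auto simp: T_def)
    then obtain r where "r \<in> G" "le r p" "le r q" using G(3) by blast
    then show "compatible P le (a \<xi>) (a \<eta>)"
      using pq G(1) trans unfolding compatible_def by (meson subsetD)
  qed
qed

text \<open>The finite support product of countably many copies of a poset.\<close>

definition list_le :: "('a \<Rightarrow> 'a \<Rightarrow> bool) \<Rightarrow> 'a list \<Rightarrow> 'a list \<Rightarrow> bool" where
  "list_le le xs ys \<longleftrightarrow> length ys \<le> length xs \<and> (\<forall>i<length ys. le (xs ! i) (ys ! i))"

lemma poset_on_lists:
  assumes "poset_on P le"
  shows "poset_on (lists P) (list_le le)"
proof -
  have refl: "le p p" if "p \<in> P" for p
    using assms that by (auto simp: poset_on_def reflp_on_def)
  have trans: "le p r" if "le p q" "le q r" "p \<in> P" "q \<in> P" "r \<in> P" for p q r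
    using assms that unfolding poset_on_def transp_on_def by blast
  have anti: "p = q" if "le p q" "le q p" "p \<in> P" "q \<in> P" for p q
    using assms that unfolding poset_on_def antisymp_on_def by blast
  have nth: "xs ! i \<in> P" if "xs \<in> lists P" "i < length xs" for xs i
    using that by (auto simp: in_lists_conv_set)
  show ?thesis
    unfolding poset_on_def reflp_on_def transp_on_def antisymp_on_def list_le_def
  proof (intro conjI ballI impI allI)
    show "le (xs ! i) (xs ! i)" if "xs \<in> lists P" "i < length xs" for xs i
      using nth[OF that] refl by blast
  next
    fix xs ys zs i
    assume *: "xs \<in> lists P" "ys \<in> lists P" "zs \<in> lists P" "i < length zs"
      "length ys \<le> length xs \<and> (\<forall>i<length ys. le (xs ! i) (ys ! i))"
      "length zs \<le> length ys \<and> (\<forall>i<length zs. le (ys ! i) (zs ! i))"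
    then show "le (xs ! i) (zs ! i)" using trans[of "xs ! i" "ys ! i" "zs ! i"] nth by auto
  next
    fix xs ys
    assume "xs \<in> lists P" "ys \<in> lists P"
      "length ys \<le> length xs \<and> (\<forall>i<length ys. le (xs ! i) (ys ! i))"
      "length xs \<le> length ys \<and> (\<forall>i<length xs. le (ys ! i) (xs ! i))"
    then show "xs = ys" by (intro nth_equalityI) (auto intro: anti nth)
  qed auto
qed

text \<open>The ccc alone need not pass to products, but the stronger property from
  \<open>MA_precaliber\<close> does: thin out an uncountable family once for each
  coordinate.\<close>

lemma MA_ccc_lists:
  fixes P :: "'q set"
  assumes universe: "aleph1 \<le>o |UNIV :: 'p set|" and MA: "MA aleph1 TYPE('p)"
    and po: "poset_on P le" and ccc: "ccc_poset P le" and sm: "small P"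
  shows "ccc_poset (lists P) (list_le le)"
proof -
  have *: "\<exists>S'\<subseteq>S. uncountable S' \<and>
      (\<forall>\<xi>\<in>S'. \<forall>\<eta>\<in>S'. \<forall>i<n. compatible P le (a \<xi> ! i) (a \<eta> ! i))"
    if "uncountable S" "\<And>\<xi>. \<xi> \<in> S \<Longrightarrow> a \<xi> \<in> lists P \<and> n \<le> length (a \<xi>)"
    for S :: "'q list set" and a and n :: nat
    using that
  proof (induction n arbitrary: S)
    case 0
    then show ?case by blast
  next
    case (Suc n)
    have "n \<le> length (a \<xi>)" "a \<xi> ! n \<in> P" if "\<xi> \<in> S" for \<xi>
      using Suc.prems(2)[OF that] by (auto simp: in_lists_conv_set)
    then obtain S' where S': "S' \<subseteq> S" "uncountable S'"
        "\<forall>\<xi>\<in>S'. \<forall>\<eta>\<in>S'. \<forall>i<n. compatible P le (a \<xi> ! i) (a \<eta> ! i)"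
      using Suc.IH[OF Suc.prems(1)] Suc.prems(2) by (metis Suc_leD)
    obtain S'' where "S'' \<subseteq> S'" "uncountable S''"
        "\<And>\<xi> \<eta>. \<xi> \<in> S'' \<Longrightarrow> \<eta> \<in> S'' \<Longrightarrow> compatible P le (a \<xi> ! n) (a \<eta> ! n)"
      using MA_precaliber[OF universe MA po ccc sm _ S'(2), of "\<lambda>\<xi>. a \<xi> ! n"]
        \<open>\<And>\<xi>. \<xi> \<in> S \<Longrightarrow> a \<xi> ! n \<in> P\<close> S'(1) by (metis subsetD)
    then show ?case using S' by (intro exI[of _ S'']) (auto simp: less_Suc_eq subset_iff)
  qed
  show ?thesis
    unfolding ccc_poset_def
  proof (intro allI impI)
    fix A assume A: "A \<subseteq> lists P" "pairwise (\<lambda>p q. \<not> compatible (lists P) (list_le le) p q) A"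
    show "countable A"
    proof (rule ccontr)
      assume unc: "uncountable A"
      have "A = (\<Union>n. {xs \<in> A. length xs = n})" by auto
      then obtain n where n: "uncountable {xs \<in> A. length xs = n}"
        using unc countable_UN[of UNIV "\<lambda>n. {xs \<in> A. length xs = n}"] by auto
      obtain S' where S': "S' \<subseteq> {xs \<in> A. length xs = n}" "uncountable S'"
          "\<forall>\<xi>\<in>S'. \<forall>\<eta>\<in>S'. \<forall>i<n. compatible P le (\<xi> ! i) (\<eta> ! i)"
        using *[OF n, of "\<lambda>x. x" n] A(1) by (auto simp: subset_iff)
      obtain xs where xs: "xs \<in> S'" using S'(2) by (metis countable_empty equals0I)
      have "uncountable (S' - {xs})" using S'(2) by simp
      then have "S' - {xs} \<noteq> {}" by (metis countable_empty)
      then obtain ys where ys: "ys \<in> S'" "xs \<noteq> ys" by blast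
      have "\<forall>i<n. \<exists>r\<in>P. le r (xs ! i) \<and> le r (ys ! i)"
        using S'(3) xs ys unfolding compatible_def by blast
      then obtain r where r: "\<And>i. i < n \<Longrightarrow> r i \<in> P \<and> le (r i) (xs ! i) \<and> le (r i) (ys ! i)"
        by metis
      have "map r [0..<n] \<in> lists P" using r by auto
      moreover have "list_le le (map r [0..<n]) xs" "list_le le (map r [0..<n]) ys"
        using r xs ys S'(1) by (auto simp: list_le_def)
      ultimately have "compatible (lists P) (list_le le) xs ys" unfolding compatible_def by blast
      moreover have "xs \<in> A" "ys \<in> A" using xs ys S'(1) by auto
      ultimately show False using A(2) ys(2) unfolding pairwise_def by blast
    qed
  qed
qed

section \<open>Consequences for complete Boolean algebras\<close>

text \<open>A trace of infinite distributivity, for which complements suffice: an element disjoint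
  from every member of \<open>X\<close> has a complement above \<open>Sup X\<close>.\<close>

lemma inf_Sup_neq_bot:
  fixes p :: "'b::{complete_lattice, boolean_algebra}"
  assumes "inf p (Sup X) \<noteq> bot"
  shows "\<exists>x\<in>X. inf p x \<noteq> bot"
proof (rule ccontr)
  assume "\<not> ?thesis"
  then have "x \<le> - p" if "x \<in> X" for x using that by (auto simp: inf_shunt[symmetric] inf_commute)
  then have "Sup X \<le> - p" by (rule Sup_least)
  then show False using assms by (simp add: inf_shunt[symmetric] inf_commute)
qed

lemma ex_countable_subalgebra:
  fixes X :: "'b::boolean_algebra set"
  assumes "countable X"
  shows "\<exists>C. countable C \<and> X \<subseteq> C \<and> bot \<in> C \<and> top \<in> C \<and>
    (\<forall>x\<in>C. - x \<in> C \<and> (\<forall>y\<in>C. inf x y \<in> C \<and> sup x y \<in> C))"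
proof -
  define F where "F S = S \<union> uminus ` S \<union> (\<lambda>(x, y). inf x y) ` (S \<times> S) \<union> (\<lambda>(x, y). sup x y) ` (S \<times> S)"
    for S :: "'b set"
  define S where "S n = (F ^^ n) (insert bot (insert top X))" for n
  have SS: "S (Suc n) = F (S n)" for n by (simp add: S_def)
  have cS: "countable (S n)" for n
    by (induction n) (simp_all add: SS assms S_def[of 0] F_def)
  have "S n \<subseteq> S (Suc n)" for n by (auto simp: SS F_def)
  then have mono: "S m \<subseteq> S n" if "m \<le> n" for m n using that by (rule lift_Suc_mono_le)
  have closed: "- x \<in> (\<Union>n. S n)" "inf x y \<in> (\<Union>n. S n)" "sup x y \<in> (\<Union>n. S n)"
    if xy: "x \<in> (\<Union>n. S n)" "y \<in> (\<Union>n. S n)" for x y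
  proof -
    obtain m n where "x \<in> S m" "y \<in> S n" using xy by blast
    then have "x \<in> S (max m n)" "y \<in> S (max m n)" using mono[of m "max m n"] mono[of n "max m n"] by auto
    then have "- x \<in> S (Suc (max m n))" "inf x y \<in> S (Suc (max m n))" "sup x y \<in> S (Suc (max m n))"
      unfolding SS F_def by force+
    then show "- x \<in> (\<Union>n. S n)" "inf x y \<in> (\<Union>n. S n)" "sup x y \<in> (\<Union>n. S n)" by blast+
  qed
  have "insert bot (insert top X) = S 0" by (simp add: S_def)
  then have sub: "insert bot (insert top X) \<subseteq> (\<Union>n. S n)" by blast
  have "countable (\<Union>n. S n)" using cS by blast
  then show ?thesis using sub
    by (intro exI[of _ "\<Union>n. S n"] conjI ballI closed) simp_all
qed

text \<open>\<open>U\<close> carries, as a locale parameter, the type \<open>'p\<close> over which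
  \<open>MA\<close> ranges. \<open>nowhere_countable\<close> is the uniform density of
  \<open>D\<close>, a set of size below \<open>aleph1\<close> being countable.\<close>

locale ma_algebra =
  fixes U :: "'p itself" and D :: "'b::{complete_lattice, boolean_algebra} set"
  assumes universe: "aleph1 \<le>o |UNIV :: 'p set|" and MA: "MA aleph1 TYPE('p)"
    and ccc: "ccc_algebra TYPE('b)"
    and small_D: "small D" and bot_notin_D: "bot \<notin> D"
    and dense_D: "p \<noteq> bot \<Longrightarrow> \<exists>d\<in>D. d \<le> p"
    and nowhere_countable: "d \<in> D \<Longrightarrow> R \<subseteq> D \<Longrightarrow> countable R \<Longrightarrow> \<exists>q\<in>D. q \<le> d \<and> (\<forall>r\<in>R. \<not> r \<le> q)"
begin

text \<open>Replacing each \<open>x\<close> in \<open>X\<close> by a member of \<open>D\<close>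
  below it reduces the claim to \<open>nowhere_countable\<close>: if \<open>q\<close> is not above
  the smaller element, it is not above \<open>x\<close>.\<close>

lemma ex_le_avoiding:
  assumes "p \<noteq> bot" "countable X" "bot \<notin> X"
  shows "\<exists>q\<in>D. q \<le> p \<and> (\<forall>x\<in>X. \<not> x \<le> q)"
proof -
  obtain d where d: "d \<in> D" "d \<le> p" using dense_D assms(1) by blast
  obtain r where r: "\<And>x. x \<in> X \<Longrightarrow> r x \<in> D \<and> r x \<le> x" using dense_D assms(3) by metis
  have "countable (r ` X)" "r ` X \<subseteq> D" using assms(2) r by auto
  then obtain q where "q \<in> D" "q \<le> d" "\<forall>s\<in>r ` X. \<not> s \<le> q"
    using nowhere_countable[OF d(1)] by blast
  then show ?thesis using d r by (meson image_eqI order_trans)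
qed

lemma ex_split:
  assumes "p \<noteq> bot"
  obtains q where "q \<in> D" "q \<le> p" "p - q \<noteq> bot"
  using ex_le_avoiding[OF assms, of "{p}"] assms by (auto simp: diff_shunt_var)

lemma disjoint_imp_countable:
  "bot \<notin> A \<Longrightarrow> pairwise (\<lambda>x y. inf x y = bot) (A :: 'b set) \<Longrightarrow> countable A"
  using ccc unfolding ccc_algebra_def by blast

lemma compatible_D_iff: "compatible D (\<le>) p q \<longleftrightarrow> inf p q \<noteq> bot"
proof
  assume "compatible D (\<le>) p q"
  then obtain r where "r \<in> D" "r \<le> inf p q" by (auto simp: compatible_def)
  then show "inf p q \<noteq> bot" using bot_notin_D by (metis bot.extremum_uniqueI)
next
  assume "inf p q \<noteq> bot"
  then show "compatible D (\<le>) p q" using dense_D unfolding compatible_def by (meson le_infE)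
qed

lemma poset_D: "poset_on D (\<le>)"
  by (auto simp: poset_on_def reflp_on_def transp_on_def antisymp_on_def)

lemma ccc_D: "ccc_poset D (\<le>)"
  unfolding ccc_poset_def compatible_D_iff
  using disjoint_imp_countable bot_notin_D by (simp add: subset_iff) blast

lemma ex_countable_antichain:
  assumes "K \<subseteq> D"
  obtains W where "W \<subseteq> K" "countable W" "pairwise (\<lambda>x y. inf x y = bot) W"
    "\<And>x. x \<in> K \<Longrightarrow> \<exists>w\<in>W. inf x w \<noteq> bot"
proof -
  obtain W where W: "W \<subseteq> K" "pairwise (\<lambda>x y. \<not> inf x y \<noteq> bot) W"
      "\<And>x. x \<in> K \<Longrightarrow> \<exists>w\<in>W. inf x w \<noteq> bot"
    by (rule ex_maximal_antichain[of K "\<lambda>x y. inf x y \<noteq> bot"])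
      (use assms bot_notin_D in \<open>auto simp: inf_commute\<close>)
  moreover have "countable W" using W(1,2) assms bot_notin_D
    by (intro disjoint_imp_countable) auto
  ultimately show ?thesis using that by simp
qed

abbreviation (input) lists_le :: "'b list \<Rightarrow> 'b list \<Rightarrow> bool" where
  "lists_le \<equiv> list_le (\<le>)"

lemma ccc_lists_D: "ccc_poset (lists D) lists_le"
  by (rule MA_ccc_lists[OF universe MA poset_D ccc_D small_D])

text \<open>The algebra adds a real: it is \<open>\<sigma>\<close>-centred, and for each of the countably many filters
  covering \<open>D\<close> there is a countable maximal antichain avoiding it.\<close>

lemma ex_countable_splitting:
  obtains Y where "countable Y" "\<And>p. p \<noteq> bot \<Longrightarrow> \<exists>y\<in>Y. inf p y \<noteq> bot \<and> p - y \<noteq> (bot :: 'b)"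
proof -
  \<comment> \<open>Coordinate \<open>n\<close> of the generic sequence generates a filter.
    \<open>E\<close> puts each member of \<open>D\<close> into one of these filters;
    \<open>E'\<close> provides, below each \<open>p\<close> and for each \<open>n\<close>, an
    element disjoint from a member of the \<open>n\<close>-th filter.\<close>
  define E where "E p = {xs \<in> lists D. \<exists>i<length xs. xs ! i \<le> p}" for p
  define E' where "E' = (\<lambda>(n, p). {xs \<in> lists D. n < length xs \<and>
    (\<exists>q\<in>D. q \<le> p \<and> inf (xs ! n) q = bot)})"
  have refl: "lists_le xs xs" for xs by (simp add: list_le_def)
  have app: "lists_le (xs @ ys) xs" for xs ys by (simp add: list_le_def nth_append)
  have nth: "xs ! i \<in> D" if "xs \<in> lists D" "i < length xs" for xs i
    using that by (auto simp: in_lists_conv_set)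
  have dE: "dense_in (lists D) lists_le (E p)" if p: "p \<in> D" for p
    unfolding dense_in_def
  proof (intro conjI ballI)
    fix xs assume "xs \<in> lists D"
    then have "xs @ [p] \<in> E p" using p by (auto simp: E_def intro!: exI[of _ "length xs"])
    then show "\<exists>d\<in>E p. lists_le d xs" using app by blast
  qed (auto simp: E_def)
  have dE': "dense_in (lists D) lists_le (E' (n, p))" if p: "p \<in> D" for n p
    unfolding dense_in_def
  proof (intro conjI ballI)
    fix xs assume xs: "xs \<in> lists D"
    \<comment> \<open>Padding with \<open>Suc n\<close> entries guarantees that coordinate
      \<open>n\<close> exists, whatever the length of \<open>xs\<close>.\<close>
    define ys where "ys = xs @ replicate (Suc n) p"
    have ys: "ys \<in> lists D" "n < length ys" "lists_le ys xs" using xs p app by (auto simp: ys_def)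
    have "\<exists>g\<in>D. \<exists>q\<in>D. g \<le> ys ! n \<and> q \<le> p \<and> inf g q = bot"
    proof (cases "inf (ys ! n) p = bot")
      case True
      then show ?thesis using nth[OF ys(1,2)] p by blast
    next
      case False
      then obtain g where g: "g \<in> D" "g \<le> inf (ys ! n) p" "inf (ys ! n) p - g \<noteq> bot"
        by (rule ex_split)
      then obtain q where q: "q \<in> D" "q \<le> inf (ys ! n) p - g" using dense_D by blast
      have "inf g q \<le> inf g (inf (ys ! n) p - g)" using q(2) by (rule inf_mono[OF order_refl])
      also have "\<dots> = bot" by (simp add: diff_eq inf_commute inf_left_commute)
      finally have "inf g q = bot" by (simp add: bot.extremum_unique)
      moreover have "q \<le> p" using q(2) by (simp add: diff_eq)
      moreover have "g \<le> ys ! n" using g(2) by simp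
      ultimately show ?thesis using g(1) q(1) by blast
    qed
    then obtain g q where gq: "g \<in> D" "q \<in> D" "g \<le> ys ! n" "q \<le> p" "inf g q = bot" by blast
    have "ys[n := g] \<in> E' (n, p)"
      using gq ys by (auto simp: E'_def set_update_subset_insert[THEN subsetD] in_lists_conv_set
          dest!: set_update_subset_insert[THEN subsetD])
    moreover have "lists_le (ys[n := g]) xs"
      using ys(2,3) gq(3) unfolding list_le_def
      by (metis length_list_update nth_list_update_eq nth_list_update_neq order_trans)
    ultimately show "\<exists>d\<in>E' (n, p). lists_le d xs" by blast
  qed (auto simp: E'_def)
  have sm: "small (E ` D \<union> E' ` (UNIV \<times> D))"
  proof -
    have "small (\<Union>x\<in>{E ` D, E' ` (UNIV \<times> D)}. x)"
    proof (rule small_UN)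
      show "small x" if "x \<in> {E ` D, E' ` (UNIV \<times> D)}" for x
        using that small_image[OF small_D, of E]
          small_image[OF small_Times[OF small_countable small_D], of "UNIV :: nat set" E'] by auto
    qed (rule small_countable, simp)
    then show ?thesis by simp
  qed
  have dense: "\<forall>X\<in>E ` D \<union> E' ` (UNIV \<times> D). dense_in (lists D) lists_le X"
    using dE dE' by auto
  obtain G where G: "G \<subseteq> lists D" "\<forall>p\<in>G. \<forall>q\<in>G. \<exists>r\<in>G. lists_le r p \<and> lists_le r q"
      "\<forall>X\<in>E ` D \<union> E' ` (UNIV \<times> D). G \<inter> X \<noteq> {}"
    using MA_generic[OF universe MA poset_on_lists[OF poset_D] ccc_lists_D small_lists[OF small_D]
        lists.Nil sm dense] by (elim exE conjE) (rule that)
  \<comment> \<open>By \<open>E'\<close> the set \<open>K n\<close> is dense, so an antichain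
    maximal in it is maximal in \<open>D\<close>, while all its members avoid the
    \<open>n\<close>-th filter.\<close>
  define K where "K n = {q \<in> D. \<exists>xs\<in>G. n < length xs \<and> inf (xs ! n) q = bot}" for n
  have "\<exists>W. W \<subseteq> K n \<and> countable W \<and> (\<forall>x\<in>K n. \<exists>w\<in>W. inf x w \<noteq> bot)" for n
    by (rule ex_countable_antichain[of "K n"]) (auto simp: K_def)
  then obtain W where W: "\<And>n. W n \<subseteq> K n" "\<And>n. countable (W n)"
      "\<And>n x. x \<in> K n \<Longrightarrow> \<exists>w\<in>W n. inf x w \<noteq> bot" by metis
  show ?thesis
  proof
    show "countable (\<Union>n. W n)" using W(2) by blast
    fix p :: 'b assume "p \<noteq> bot"
    then obtain d where d: "d \<in> D" "d \<le> p" using dense_D by blast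
    obtain xs where xs: "xs \<in> G" "xs \<in> E d" using G(3) d by blast
    then obtain n where n: "n < length xs" "xs ! n \<le> d" by (auto simp: E_def)
    have "E' (n, d) \<in> E ` D \<union> E' ` (UNIV \<times> D)" using d(1) by blast
    then obtain ys where ys: "ys \<in> G" "ys \<in> E' (n, d)" using G(3) by blast
    then obtain q where q: "q \<in> K n" "q \<le> d" by (auto simp: E'_def K_def)
    then obtain y where y: "y \<in> W n" "inf q y \<noteq> bot" using W(3) by blast
    have "inf q y \<le> inf p y" using q(2) d(2) by (meson inf_mono order_refl order_trans)
    then have "inf p y \<noteq> bot" using y(2) by (metis bot.extremum_uniqueI)
    moreover have "\<not> p \<le> y"
    proof
      \<comment> \<open>Now \<open>d\<close>, hence \<open>y\<close>, would belong to the
        \<open>n\<close>-th filter, while \<open>y\<close> is disjoint from a member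
        \<open>zs ! n\<close> of it.\<close>
      assume "p \<le> y"
      obtain zs where zs: "zs \<in> G" "n < length zs" "inf (zs ! n) y = bot"
        using y(1) W(1) by (auto simp: K_def)
      obtain ws where ws: "ws \<in> G" "lists_le ws xs" "lists_le ws zs" using G(2) xs(1) zs(1) by blast
      then have le: "ws ! n \<le> xs ! n" "ws ! n \<le> zs ! n" "n < length ws"
        using n(1) zs(2) by (auto simp: list_le_def)
      then have "ws ! n \<le> inf (zs ! n) y" using n(2) d(2) \<open>p \<le> y\<close> by (meson le_inf_iff order_trans)
      then have "ws ! n = bot" using zs(3) by (simp add: bot.extremum_unique)
      moreover have "ws ! n \<in> D" using nth ws(1) G(1) le(3) by blast
      ultimately show False using bot_notin_D by metis
    qed
    ultimately show "\<exists>y\<in>\<Union>n. W n. inf p y \<noteq> bot \<and> p - y \<noteq> bot"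
      using y(1) by (auto simp: diff_shunt_var)
  qed
qed

text \<open>The pieces available for building one coordinate of the Cohen sequence. By the first two
  clauses a piece can be used to decide the coordinate below a given element while changing little;
  by the last one no finite stage decides it below a member of \<open>N\<close>.\<close>

definition coordinate_ideal :: "'b set \<Rightarrow> 'b set \<Rightarrow> bool" where
  "coordinate_ideal N I \<longleftrightarrow> countable I \<and> bot \<in> I \<and>
    (\<forall>x\<in>I. \<forall>y\<in>I. sup x y \<in> I \<and> x - y \<in> I) \<and>
    (\<forall>p. \<forall>A. p \<noteq> bot \<longrightarrow> finite A \<longrightarrow> bot \<notin> A \<longrightarrow>
      (\<exists>x\<in>I. inf p x \<noteq> bot \<and> (\<forall>a\<in>A. a - x \<noteq> bot))) \<and>
    (\<forall>p\<in>N. \<forall>x\<in>I. p - x \<noteq> bot)"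

text \<open>Among the antichains no finite part of which covers a member of \<open>N\<close>, take a
  maximal one, \<open>Q\<close>. The ideal consists of the elements below finite joins from
  \<open>Q\<close>, cut down to a countable subalgebra that contains \<open>Q\<close> and a
  splitting family. Uniform density makes \<open>Q\<close> meet every nonzero element, so pieces can
  be found everywhere.\<close>

lemma ex_coordinate_ideal:
  assumes N: "countable N" "bot \<notin> N"
  shows "\<exists>I. coordinate_ideal N I"
proof -
  obtain Y where Y: "countable Y" "\<And>p. p \<noteq> bot \<Longrightarrow> \<exists>y\<in>Y. inf p y \<noteq> bot \<and> p - y \<noteq> (bot :: 'b)"
    by (rule ex_countable_splitting) (rule that)
  let ?\<A> = "{Q. Q \<subseteq> D \<and> pairwise (\<lambda>x y. inf x y = bot) Q \<and>
    (\<forall>F\<subseteq>Q. finite F \<longrightarrow> (\<forall>p\<in>N. \<not> p \<le> Sup F))}"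
  have "\<exists>M\<in>?\<A>. \<forall>X\<in>?\<A>. M \<subseteq> X \<longrightarrow> X = M"
  proof (rule subset_Zorn_nonempty)
    have "{} \<in> ?\<A>" using N(2) by (auto simp: bot.extremum_unique)
    then show "?\<A> \<noteq> {}" by (rule ex_in_conv[THEN iffD1, OF exI])
    fix \<C> assume \<C>: "\<C> \<noteq> {}" "subset.chain ?\<A> \<C>"
    have "pairwise (\<lambda>x y. inf x y = bot) (\<Union>\<C>)"
      using \<C>(2) by (intro pairwise_chain_Union[OF _ chain_imp_chain_subset])
        (auto simp: subset.chain_def)
    moreover have "\<not> p \<le> Sup F" if F: "F \<subseteq> \<Union>\<C>" "finite F" "p \<in> N" for F p
    proof -
      obtain C where "C \<in> \<C>" "F \<subseteq> C"
        using finite_subset_Union_chain[OF F(2,1) \<C>(1,2)] by blast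
      then show ?thesis using F(2,3) \<C>(2) by (auto simp: subset.chain_def)
    qed
    ultimately show "\<Union>\<C> \<in> ?\<A>" using \<C>(2) by (auto simp: subset.chain_def)
  qed
  then obtain Q where Q: "Q \<in> ?\<A>" and max: "\<forall>X\<in>?\<A>. Q \<subseteq> X \<longrightarrow> X = Q" ..
  have QD: "Q \<subseteq> D" and disj: "pairwise (\<lambda>x y. inf x y = bot) Q"
    and cov: "\<And>F p. F \<subseteq> Q \<Longrightarrow> finite F \<Longrightarrow> p \<in> N \<Longrightarrow> \<not> p \<le> Sup F" using Q by auto
  have "countable Q" using QD disj bot_notin_D by (intro disjoint_imp_countable) auto
  have meets: "\<exists>q\<in>Q. inf p q \<noteq> bot" if p: "p \<noteq> bot" for p
  proof (rule ccontr)
    assume no: "\<not> ?thesis"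
    \<comment> \<open>If \<open>r\<close> in \<open>N\<close> were covered by \<open>q\<close> and
      finitely many members of \<open>Q\<close>, then \<open>q\<close> would lie above one of these
      remainders. They are countably many and nonzero, so \<open>ex_le_avoiding\<close> gives a
      \<open>q\<close> that can be added to \<open>Q\<close>.\<close>
    let ?X = "(\<lambda>(p, F). p - Sup F) ` (N \<times> {F. finite F \<and> F \<subseteq> Q})"
    have cX: "countable ?X"
      using N(1) \<open>countable Q\<close> by (intro countable_image countable_SIGMA countable_Collect_finite_subset)
    have bX: "bot \<notin> ?X" using cov by (auto simp: diff_shunt_var eq_commute[of bot])
    obtain q where q: "q \<in> D" "q \<le> p" "\<forall>x\<in>?X. \<not> x \<le> q"
      using ex_le_avoiding[OF p cX bX] by (elim bexE conjE) (rule that)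
    have dq: "inf q w = bot" if "w \<in> Q" for w
      using no q(2) that by (metis bot.extremum_uniqueI inf_mono order_refl)
    have "insert q Q \<in> ?\<A>"
    proof (intro CollectI conjI allI impI ballI)
      show "insert q Q \<subseteq> D" using q QD by blast
      show "pairwise (\<lambda>x y. inf x y = bot) (insert q Q)"
        using disj dq by (auto simp: pairwise_insert inf_commute)
      fix F r assume F: "F \<subseteq> insert q Q" "finite F" "r \<in> N"
      show "\<not> r \<le> Sup F"
      proof
        assume "r \<le> Sup F"
        also have "\<dots> \<le> sup q (Sup (F - {q}))" 
        proof (rule Sup_least)
          show "x \<le> sup q (Sup (F - {q}))" if "x \<in> F" for x
            using that by (cases "x = q") (auto intro: le_supI2 Sup_upper)
        qed
        finally have "r - Sup (F - {q}) \<le> q" by (simp add: diff_eq shunt1 sup_commute)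
        moreover have "r - Sup (F - {q}) \<in> ?X"
          using F by (intro image_eqI[of _ _ "(r, F - {q})"]) auto
        ultimately show False using q(3) by blast
      qed
    qed
    then have "insert q Q = Q" by (rule max[rule_format, OF _ subset_insertI])
    then have "inf q q = bot" using dq by blast
    then show False using q(1) bot_notin_D by simp
  qed
  obtain C where C: "countable C" "Y \<union> Q \<subseteq> C" "bot \<in> C" "top \<in> C"
      "\<forall>x\<in>C. - x \<in> C \<and> (\<forall>y\<in>C. inf x y \<in> C \<and> sup x y \<in> C)"
    using ex_countable_subalgebra[of "Y \<union> Q"] Y(1) \<open>countable Q\<close> by auto
  have small_piece: "\<exists>y\<in>C. inf p y \<noteq> bot \<and> (\<forall>a\<in>A. a - y \<noteq> bot)"
    if "finite A" "bot \<notin> A" "p \<noteq> bot" for A p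
    using that
  proof (induction A rule: finite_induct)
    case empty
    then show ?case using C(4) by (intro bexI[of _ top]) auto
  next
    case (insert a A)
    then obtain y where y: "y \<in> C" "inf p y \<noteq> bot" "\<forall>a\<in>A. a - y \<noteq> bot" by auto
    obtain z where z: "z \<in> Y" "inf (inf p y) z \<noteq> bot" "inf p y - z \<noteq> bot" using Y(2)[OF y(2)] by blast
    have zC: "inf y z \<in> C" "inf y (- z) \<in> C" using C y(1) z(1) by auto
    have mono: "b - inf y u \<noteq> bot" if "b - y \<noteq> bot" for b u
      using that by (auto simp: diff_shunt_var)
    \<comment> \<open>Both halves of \<open>y\<close> meet \<open>p\<close>, and the nonzero
      \<open>a\<close> cannot be below both of them; a half that does not cover \<open>a\<close> is
      kept. Shrinking \<open>y\<close> preserves what was achieved for the earlier elements.\<close>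
    have "a - inf y z \<noteq> bot \<or> a - inf y (- z) \<noteq> bot"
    proof (rule ccontr)
      assume "\<not> ?thesis"
      then have "a \<le> z" "a \<le> - z" by (auto simp: diff_shunt_var)
      then have "a \<le> inf z (- z)" by (rule le_infI)
      then have "a = bot" by (simp only: inf_compl_bot bot_unique)
      then show False using insert.prems by simp
    qed
    then show ?case
    proof
      assume "a - inf y z \<noteq> bot"
      then show ?thesis using zC(1) z(2) y(3) mono
        by (intro bexI[of _ "inf y z"]) (auto simp: inf_assoc)
    next
      assume "a - inf y (- z) \<noteq> bot"
      then have "\<forall>b\<in>insert a A. b - inf y (- z) \<noteq> bot" using y(3) mono by blast
      moreover have "inf p (inf y (- z)) \<noteq> bot" using z(3) by (simp add: diff_eq inf_assoc)
      ultimately show ?thesis using zC(2) by blast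
    qed
  qed
  define I where "I = {x \<in> C. \<exists>F\<subseteq>Q. finite F \<and> x \<le> Sup F}"
  have "coordinate_ideal N I"
    unfolding coordinate_ideal_def
  proof (intro conjI ballI allI impI)
    show "countable I" unfolding I_def using C(1) by simp
    show "bot \<in> I" unfolding I_def using C(3) by auto
    show "sup x y \<in> I" if xy: "x \<in> I" "y \<in> I" for x y
    proof -
      obtain F F' where "F \<subseteq> Q" "finite F" "x \<le> Sup F" "F' \<subseteq> Q" "finite F'" "y \<le> Sup F'"
        using xy by (auto simp: I_def)
      then have "F \<union> F' \<subseteq> Q \<and> finite (F \<union> F') \<and> sup x y \<le> Sup (F \<union> F')"
        by (auto simp: Sup_union_distrib intro: le_supI1 le_supI2)
      moreover have "sup x y \<in> C" using that C(5) by (auto simp: I_def)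
      ultimately show ?thesis unfolding I_def by blast
    qed
    show "x - y \<in> I" if "x \<in> I" "y \<in> I" for x y
    proof -
      have "x - y \<in> C" using that C(5) by (auto simp: I_def diff_eq)
      moreover have "x - y \<le> x" by (simp add: diff_eq)
      ultimately show ?thesis using that(1) unfolding I_def by (auto intro: order_trans)
    qed
    show "p - x \<noteq> bot" if "p \<in> N" "x \<in> I" for p x
      using that cov by (auto simp: I_def diff_shunt_var dest: order_trans)
    fix p :: 'b and A :: "'b set" assume pA: "p \<noteq> bot" "finite A" "bot \<notin> A"
    obtain q where q: "q \<in> Q" "inf p q \<noteq> bot" using meets pA(1) by blast
    obtain y where y: "y \<in> C" "inf (inf p q) y \<noteq> bot" "\<forall>a\<in>A. a - y \<noteq> bot"
      using small_piece[OF pA(2,3) q(2)] by blast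
    have "inf q y \<in> I"
      using q y C(2,5) unfolding I_def by (auto intro!: exI[of _ "{q}"])
    moreover have "inf p (inf q y) \<noteq> bot" using y(2) by (simp add: inf_assoc)
    moreover have "a - inf q y \<noteq> bot" if "a \<in> A" for a
      using y(3) that by (auto simp: diff_shunt_var)
    ultimately show "\<exists>x\<in>I. inf p x \<noteq> bot \<and> (\<forall>a\<in>A. a - x \<noteq> bot)" by blast
  qed
  then show ?thesis by blast
qed

end

text \<open>The elements that \<open>I \<alpha>\<close> must not cover. Protecting every nonzero
  remainder, and not merely each \<open>d \<gamma>\<close>, lets pieces from several stages be
  removed in turn. \<open>bot\<close> is excluded because \<open>d \<gamma>\<close> may be covered
  by pieces from stages before \<open>\<gamma>\<close>; \<open>{..\<alpha>}\<close> is closed so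
  that \<open>d \<alpha>\<close> is protected from stage \<open>\<alpha>\<close> on.\<close>

definition residues ::
    "(omega1 \<Rightarrow> 'b::{complete_lattice, boolean_algebra}) \<Rightarrow> (omega1 \<Rightarrow> 'b set) \<Rightarrow> omega1 \<Rightarrow> 'b set"
  where
  "residues d I \<alpha> =
    (\<lambda>(\<gamma>, F). d \<gamma> - Sup F) ` ({..\<alpha>} \<times> {F. finite F \<and> F \<subseteq> (\<Union>\<beta>\<in>{..<\<alpha>}. I \<beta>)}) - {bot}"

text \<open>\<open>residues d I \<alpha>\<close> depends on \<open>I\<close> below
  \<open>\<alpha>\<close> only, so the recursion is well-founded; it is countable because
  \<open>\<alpha>\<close> has countably many predecessors with countable ideals, so
  \<open>ex_coordinate_ideal\<close> supplies the next ideal.\<close>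

lemma (in ma_algebra) ex_coordinate_ideals:
  "\<exists>I :: omega1 \<Rightarrow> 'b set. \<forall>\<alpha>. coordinate_ideal (residues d I \<alpha>) (I \<alpha>)"
proof (rule dependent_wf_choice[where R = "{(x, y). x < y}"])
  show "wf {(x, y). x < (y :: omega1)}" by (rule wf)
next
  fix f g :: "omega1 \<Rightarrow> 'b set" and \<alpha> r
  assume "\<And>\<beta>. (\<beta>, \<alpha>) \<in> {(x, y). x < y} \<Longrightarrow> f \<beta> = g \<beta>"
  then have "residues d f \<alpha> = residues d g \<alpha>" by (simp add: residues_def)
  then show "coordinate_ideal (residues d f \<alpha>) r = coordinate_ideal (residues d g \<alpha>) r" by simp
next
  fix \<alpha> and f :: "omega1 \<Rightarrow> 'b set"
  assume IH: "\<And>\<beta>. (\<beta>, \<alpha>) \<in> {(x, y). x < y} \<Longrightarrow> coordinate_ideal (residues d f \<beta>) (f \<beta>)"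
  have "countable (f \<beta>)" if "\<beta> < \<alpha>" for \<beta>
    using IH[of \<beta>] that by (simp add: coordinate_ideal_def)
  moreover have "countable {..<\<alpha>}"
    by (rule countable_subset[OF _ countable_atMost_omega1[of \<alpha>]]) auto
  ultimately have "countable (\<Union>\<beta>\<in>{..<\<alpha>}. f \<beta>)" by (intro countable_UN) simp_all
  then have "countable (residues d f \<alpha>)"
    unfolding residues_def
    by (intro countable_Diff countable_image countable_SIGMA countable_atMost_omega1
        countable_Collect_finite_subset)
  then show "\<exists>I. coordinate_ideal (residues d f \<alpha>) I"
    by (rule ex_coordinate_ideal) (simp add: residues_def)
qed

section \<open>The poset of finite approximations\<close>

locale cohen_poset = ma_algebra U D for U :: "'p itself" and D :: "'b::{complete_lattice, boolean_algebra} set" +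
  fixes d :: "omega1 \<Rightarrow> 'b" and I :: "omega1 \<Rightarrow> 'b set"
  assumes range_d: "range d = D" and ideals: "coordinate_ideal (residues d I \<alpha>) (I \<alpha>)"
begin

lemma countable_I: "countable (I \<alpha>)"
  and bot_in_I: "bot \<in> I \<alpha>"
  and sup_in_I: "x \<in> I \<alpha> \<Longrightarrow> y \<in> I \<alpha> \<Longrightarrow> sup x y \<in> I \<alpha>"
  and diff_in_I: "x \<in> I \<alpha> \<Longrightarrow> y \<in> I \<alpha> \<Longrightarrow> x - y \<in> I \<alpha>"
  using ideals[of \<alpha>] by (simp_all add: coordinate_ideal_def)

lemma ex_piece:
  assumes "p \<noteq> bot" "finite A" "bot \<notin> A"
  shows "\<exists>x\<in>I \<alpha>. inf p x \<noteq> bot \<and> (\<forall>a\<in>A. a - x \<noteq> bot)"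
proof -
  have "\<forall>p A. p \<noteq> bot \<longrightarrow> finite A \<longrightarrow> bot \<notin> A \<longrightarrow>
      (\<exists>x\<in>I \<alpha>. inf p x \<noteq> bot \<and> (\<forall>a\<in>A. a - x \<noteq> bot))"
    using ideals[of \<alpha>] unfolding coordinate_ideal_def by (elim conjE)
  then show ?thesis using assms by blast
qed

lemma residue_diff:
  assumes "p \<in> residues d I \<alpha>" "x \<in> I \<alpha>"
  shows "p - x \<noteq> bot"
proof -
  have "\<forall>p\<in>residues d I \<alpha>. \<forall>x\<in>I \<alpha>. p - x \<noteq> bot"
    using ideals[of \<alpha>] unfolding coordinate_ideal_def by (elim conjE)
  then show ?thesis using assms by blast
qed

lemma d_in_D: "d \<gamma> \<in> D"
  using range_d by blast

lemma Sup_in_I: "finite F \<Longrightarrow> F \<subseteq> I \<alpha> \<Longrightarrow> Sup F \<in> I \<alpha>"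
  by (induction F rule: finite_induct) (auto simp: bot_in_I sup_in_I)

text \<open>Remove the pieces from the lowest stage to the highest: what is left before the top
  stage \<open>\<beta>\<close> is a nonzero remainder, that is, a residue at \<open>\<beta>\<close>,
  and \<open>I \<beta>\<close> does not cover it.\<close>

lemma d_diff_Sup_neq_bot:
  assumes "finite F" "F \<subseteq> (\<Union>\<alpha>\<in>{\<gamma>..}. I \<alpha>)"
  shows "d \<gamma> - Sup F \<noteq> bot"
proof -
  have *: "d \<gamma> - Sup F \<noteq> bot" if "finite w" "w \<subseteq> {\<gamma>..}" "finite F" "F \<subseteq> (\<Union>\<alpha>\<in>w. I \<alpha>)" for w F
    using that
  proof (induction w arbitrary: F rule: finite_linorder_max_induct)
    case empty
    then show ?case using d_in_D[of \<gamma>] bot_notin_D by (auto simp: diff_eq)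
  next
    case (insert \<beta> w)
    \<comment> \<open>Pieces are sorted by membership in \<open>I \<beta>\<close>, whichever stage
      they were taken from; those outside must come from the lower stages in
      \<open>w\<close>.\<close>
    have fin: "finite (F - I \<beta>)" "finite (F \<inter> I \<beta>)" using insert.prems(2) by auto
    have sub: "F - I \<beta> \<subseteq> (\<Union>\<alpha>\<in>w. I \<alpha>)" using insert.prems(3) by auto
    have "d \<gamma> - Sup (F - I \<beta>) \<noteq> bot" using insert.IH[OF _ fin(1) sub] insert.prems(1) by simp
    moreover have "F - I \<beta> \<subseteq> (\<Union>\<alpha>\<in>{..<\<beta>}. I \<alpha>)" using sub insert.hyps(2) by blast
    moreover have "\<gamma> \<le> \<beta>" using insert.prems(1) by simp
    ultimately have "d \<gamma> - Sup (F - I \<beta>) \<in> residues d I \<beta>"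
      unfolding residues_def using fin(1) by (intro DiffI image_eqI[of _ _ "(\<gamma>, F - I \<beta>)"]) auto
    then have "d \<gamma> - Sup (F - I \<beta>) - Sup (F \<inter> I \<beta>) \<noteq> bot"
      using fin(2) by (intro residue_diff[of _ \<beta>] Sup_in_I) auto
    moreover have "F = (F - I \<beta>) \<union> (F \<inter> I \<beta>)" by blast
    then have "Sup F = sup (Sup (F - I \<beta>)) (Sup (F \<inter> I \<beta>))" by (metis Sup_union_distrib)
    ultimately show ?case by (simp add: diff_eq inf_assoc)
  qed
  have "\<forall>x\<in>F. \<exists>\<alpha>. \<gamma> \<le> \<alpha> \<and> x \<in> I \<alpha>" using assms(2) by auto
  then obtain h where h: "\<forall>x\<in>F. \<gamma> \<le> h x \<and> x \<in> I (h x)" by metis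
  show ?thesis by (rule *[of "h ` F"]) (use assms(1) h in auto)
qed

text \<open>A condition \<open>(b, R)\<close> approximates the generic coordinates from below, \<open>val b \<alpha> i\<close> being the
  part on which coordinate \<open>\<alpha>\<close> has been given the value \<open>i\<close>. A pair \<open>(p, v) \<in> R\<close> is the promise that,
  apart from the finitely many coordinates in \<open>v\<close>, part of \<open>p\<close> stays undecided at every stage.\<close>

definition val :: "(omega1 \<times> bool \<times> 'b) set \<Rightarrow> omega1 \<Rightarrow> bool \<Rightarrow> 'b" where
  "val b \<alpha> i = Sup {x. (\<alpha>, i, x) \<in> b}"

definition cover :: "(omega1 \<times> bool \<times> 'b) set \<Rightarrow> omega1 set \<Rightarrow> 'b" where
  "cover b v = Sup {x. \<exists>\<alpha> i. (\<alpha>, i, x) \<in> b \<and> \<alpha> \<notin> v}"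

definition conds :: "((omega1 \<times> bool \<times> 'b) set \<times> ('b \<times> omega1 set) set) set" where
  "conds = {(b, R). finite b \<and> (\<forall>(\<alpha>, i, x)\<in>b. x \<in> I \<alpha>) \<and> finite R \<and> R \<subseteq> D \<times> Fpow UNIV \<and>
    (\<forall>\<alpha>. inf (val b \<alpha> True) (val b \<alpha> False) = bot) \<and> (\<forall>(p, v)\<in>R. p - cover b v \<noteq> bot)}"

definition refines where
  "refines c c' \<longleftrightarrow> fst c' \<subseteq> fst c \<and> snd c' \<subseteq> snd c"

lemma conds_finite: "c \<in> conds \<Longrightarrow> finite (fst c)" "c \<in> conds \<Longrightarrow> finite (snd c)"
  and conds_piece: "c \<in> conds \<Longrightarrow> (\<alpha>, i, x) \<in> fst c \<Longrightarrow> x \<in> I \<alpha>"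
  and conds_disjoint: "c \<in> conds \<Longrightarrow> inf (val (fst c) \<alpha> True) (val (fst c) \<alpha> False) = bot"
  and conds_promise: "c \<in> conds \<Longrightarrow> (p, v) \<in> snd c \<Longrightarrow> p - cover (fst c) v \<noteq> bot"
  and conds_promise_in_D: "c \<in> conds \<Longrightarrow> (p, v) \<in> snd c \<Longrightarrow> p \<in> D"
  by (auto simp: conds_def)

lemma val_mono: "b \<subseteq> b' \<Longrightarrow> val b \<alpha> i \<le> val b' \<alpha> i"
  unfolding val_def by (rule Sup_subset_mono) auto

lemma cover_mono: "b \<subseteq> b' \<Longrightarrow> cover b v \<le> cover b' v"
  unfolding cover_def by (rule Sup_subset_mono) auto

lemma val_le_cover: "\<alpha> \<notin> v \<Longrightarrow> val b \<alpha> i \<le> cover b v"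
  unfolding val_def cover_def by (rule Sup_subset_mono) auto

text \<open>Lets the part already decided at \<open>\<alpha>\<close> be subtracted from a new piece
  without leaving \<open>I \<alpha>\<close>.\<close>

lemma val_in_I:
  assumes "(b, R) \<in> conds"
  shows "val b \<alpha> i \<in> I \<alpha>"
  unfolding val_def
proof (rule Sup_in_I)
  have "{x. (\<alpha>, i, x) \<in> b} \<subseteq> (snd \<circ> snd) ` b" by force
  then show "finite {x. (\<alpha>, i, x) \<in> b}" using assms by (auto simp: conds_def intro: finite_subset)
qed (use assms in \<open>auto simp: conds_def\<close>)

lemma diff_mono_neq_bot: "p - y \<noteq> bot \<Longrightarrow> x \<le> y \<Longrightarrow> p - x \<noteq> (bot :: 'b)"
  by (auto simp: diff_shunt_var intro: order_trans)

text \<open>Within a filter, a promise made by one condition can be joined to any other: a common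
  refinement has both, and dropping the rest leaves a condition.\<close>

lemma conds_hereditary:
  assumes "c \<in> conds" "refines c c'"
  shows "c' \<in> conds"
proof -
  obtain b R b' R' where eq: "c = (b, R)" "c' = (b', R')" by fastforce
  have sub: "b' \<subseteq> b" "R' \<subseteq> R" using assms(2) eq by (auto simp: refines_def)
  have "inf (val b' \<alpha> True) (val b' \<alpha> False) = bot" for \<alpha>
  proof -
    have "inf (val b' \<alpha> True) (val b' \<alpha> False) \<le> inf (val b \<alpha> True) (val b \<alpha> False)"
      using sub(1) by (intro inf_mono val_mono)
    also have "\<dots> = bot" using assms(1) eq by (simp add: conds_def)
    finally show ?thesis by (simp only: bot_unique)
  qed
  moreover have "p - cover b' v \<noteq> bot" if "(p, v) \<in> R'" for p v
  proof (rule diff_mono_neq_bot[OF _ cover_mono[OF sub(1)]])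
    show "p - cover b v \<noteq> bot" using that sub(2) assms(1) eq by (auto simp: conds_def)
  qed
  moreover have "finite b'" "finite R'" using assms(1) eq sub by (auto simp: conds_def intro: finite_subset)
  moreover have "\<forall>(\<alpha>, i, x)\<in>b'. x \<in> I \<alpha>" "R' \<subseteq> D \<times> Fpow UNIV"
    using assms(1) eq sub by (auto simp: conds_def)
  ultimately show ?thesis unfolding eq conds_def by blast
qed

lemma poset_conds: "poset_on conds refines"
  by (auto simp: poset_on_def reflp_on_def transp_on_def antisymp_on_def refines_def)

lemma small_conds: "small conds"
proof -
  have "small (\<Union>\<alpha>. {\<alpha>} \<times> (UNIV :: bool set) \<times> I \<alpha>)"
    by (intro small_UN small_omega1 small_countable countable_SIGMA countable_I) simp_all
  then have Z: "small (Fpow (\<Union>\<alpha>. {\<alpha>} \<times> (UNIV :: bool set) \<times> I \<alpha>))" by (rule small_Fpow)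
  have "small (Fpow (D \<times> Fpow (UNIV :: omega1 set)))"
    by (intro small_Fpow small_Times small_D small_omega1)
  from small_Times[OF Z this] show ?thesis
    by (rule small_subset[rotated]) (auto simp: conds_def Fpow_def)
qed

text \<open>The union is the common refinement. On the root both conditions have the same pieces,
  and off the root no coordinate is shared, so disjointness is inherited. A promise of one condition
  is threatened only by pieces of the other that lie off the root.\<close>

lemma compatible_condsI:
  assumes c: "(b, R) \<in> conds" and c': "(b', R') \<in> conds"
    and root: "\<And>t. fst t \<in> w \<Longrightarrow> t \<in> b \<longleftrightarrow> t \<in> b'"
    and disj: "fst ` b \<inter> fst ` b' \<subseteq> w"
    and R: "\<And>p v. (p, v) \<in> R \<Longrightarrow> p - cover b v - cover b' w \<noteq> bot"
    and R': "\<And>p v. (p, v) \<in> R' \<Longrightarrow> p - cover b' v - cover b w \<noteq> bot"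
  shows "compatible conds refines (b, R) (b', R')"
proof -
  have cover: "cover (b \<union> b') v \<le> sup (cover b v) (cover b' w)"
    if root: "\<And>t. fst t \<in> w \<Longrightarrow> t \<in> b \<longleftrightarrow> t \<in> b'" for b b' v
  proof -
    have "x \<le> sup (cover b v) (cover b' w)" if x: "(\<alpha>, i, x) \<in> b \<union> b'" "\<alpha> \<notin> v" for \<alpha> i x
    proof (cases "(\<alpha>, i, x) \<in> b")
      case True
      then show ?thesis using x(2) unfolding cover_def by (intro le_supI1 Sup_upper) auto
    next
      case False
      then have "(\<alpha>, i, x) \<in> b'" "\<alpha> \<notin> w"
        using x(1) root[of "(\<alpha>, i, x)"] by auto
      then show ?thesis unfolding cover_def by (intro le_supI2 Sup_upper) auto
    qed
    then show ?thesis unfolding cover_def[of "b \<union> b'"] by (intro Sup_least) blast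
  qed
  have prom: "p - cover (b \<union> b') v \<noteq> bot" if "(p, v) \<in> R \<union> R'" for p v
  proof (cases "(p, v) \<in> R")
    case True
    have "p - sup (cover b v) (cover b' w) \<noteq> bot"
      using R[OF True] by (simp add: diff_eq inf_assoc)
    then show ?thesis using cover[OF root] by (rule diff_mono_neq_bot)
  next
    case False
    then have "p - sup (cover b' v) (cover b w) \<noteq> bot"
      using R'[of p v] that by (simp add: diff_eq inf_assoc)
    moreover have "cover (b \<union> b') v \<le> sup (cover b' v) (cover b w)"
      using cover[of b' b v] root by (simp add: Un_commute)
    ultimately show ?thesis by (rule diff_mono_neq_bot)
  qed
  have "inf (val (b \<union> b') \<alpha> True) (val (b \<union> b') \<alpha> False) = bot" for \<alpha>
  proof -
    have "val (b \<union> b') \<alpha> i = val b \<alpha> i" if "\<alpha> \<notin> fst ` b' - w" for i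
    proof -
      have "{x. (\<alpha>, i, x) \<in> b \<union> b'} = {x. (\<alpha>, i, x) \<in> b}"
        using that root[of "(\<alpha>, i, _)"] by (force simp: image_iff)
      then show ?thesis by (simp add: val_def)
    qed
    moreover have "val (b \<union> b') \<alpha> i = val b' \<alpha> i" if "\<alpha> \<notin> fst ` b - w" for i
    proof -
      have "{x. (\<alpha>, i, x) \<in> b \<union> b'} = {x. (\<alpha>, i, x) \<in> b'}"
        using that root[of "(\<alpha>, i, _)"] by (force simp: image_iff)
      then show ?thesis by (simp add: val_def)
    qed
    moreover have "\<alpha> \<notin> fst ` b - w \<or> \<alpha> \<notin> fst ` b' - w" using disj by blast
    ultimately show ?thesis using c c' by (auto simp: conds_def)
  qed
  then have "(b \<union> b', R \<union> R') \<in> conds"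
    using c c' prom unfolding conds_def by auto
  then show ?thesis unfolding compatible_def by (rule bexI[rotated]) (simp add: refines_def)
qed

text \<open>The two promise clauses of \<open>compatible_condsI\<close> are met in different ways. A
  first condition \<open>c\<close> is used to shrink a list to \<open>q2\<close>, disjoint from the
  pieces of \<open>c\<close> off the root. A second condition \<open>c'\<close> is then chosen so
  that its remainders meet \<open>q2\<close>, which saves its own promises, and so that its pieces
  off the root do not cover the remainders of \<open>c\<close>.\<close>

lemma ccc_conds: "ccc_poset conds refines"
  unfolding ccc_poset_def
proof (intro allI impI)
  fix A assume A: "A \<subseteq> conds" and anti: "pairwise (\<lambda>p q. \<not> compatible conds refines p q) A"
  show "countable A"
  proof (rule ccontr)
    assume "uncountable A"
    have fin: "\<forall>c\<in>A. finite (fst ` fst c)" using A by (auto simp: conds_def)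
    obtain T w where T: "T \<subseteq> A" "uncountable T" "finite w"
        "\<forall>\<alpha>. \<alpha> \<notin> w \<longrightarrow> countable {c \<in> T. \<alpha> \<in> fst ` fst c}"
      using ex_root[of A "\<lambda>c. fst ` fst c", OF \<open>uncountable A\<close> fin] by (elim exE conjE) (rule that)
    \<comment> \<open>The trace on the root takes only countably many values because
      \<open>w\<close> is finite and each ideal is countable.\<close>
    define f where "f c = ({t \<in> fst c. fst t \<in> w}, card (snd c))"
      for c :: "(omega1 \<times> bool \<times> 'b) set \<times> ('b \<times> omega1 set) set"
    let ?Z = "\<Union>\<alpha>\<in>w. {\<alpha>} \<times> (UNIV :: bool set) \<times> I \<alpha>"
    have "f c \<in> {F. finite F \<and> F \<subseteq> ?Z} \<times> UNIV" if "c \<in> T" for c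
    proof -
      have "c \<in> conds" using that T(1) A by blast
      then show ?thesis unfolding f_def conds_def by (cases c) auto
    qed
    then have "f ` T \<subseteq> {F. finite F \<and> F \<subseteq> ?Z} \<times> UNIV" by blast
    moreover have "countable ?Z"
      using T(3) by (intro countable_UN countable_SIGMA countable_I countable_finite) simp_all
    then have "countable ({F. finite F \<and> F \<subseteq> ?Z} \<times> (UNIV :: nat set))"
      by (intro countable_SIGMA countable_Collect_finite_subset) simp_all
    ultimately have "countable (f ` T)" by (rule countable_subset)
    then obtain y where y: "uncountable {c \<in> T. f c = y}" using uncountable_fibre[OF T(2)] by blast
    define S where "S = {c \<in> T. f c = y}"
    have S: "uncountable S" "S \<subseteq> A" "S \<subseteq> conds" using y T(1) A by (auto simp: S_def)
    define n where "n = snd y"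
    have root: "{t \<in> fst c. fst t \<in> w} = {t \<in> fst c'. fst t \<in> w}" if "c \<in> S" "c' \<in> S" for c c'
      using that by (auto simp: S_def f_def)
    have card: "card (snd c) = n" if "c \<in> S" for c using that by (auto simp: S_def f_def n_def)
    \<comment> \<open>A coordinate off the root occurs in countably many conditions only; hence all
      but countably many conditions avoid a given countable \<open>K\<close> there.\<close>
    have rare: "countable {c \<in> S. (fst ` fst c - w) \<inter> K \<noteq> {}}" if "countable K" for K
    proof -
      have "countable (\<Union>\<alpha>\<in>K - w. {c \<in> T. \<alpha> \<in> fst ` fst c})" using that T(4) by auto
      then show ?thesis by (rule countable_subset[rotated]) (auto simp: S_def)
    qed
    \<comment> \<open>\<open>xs c\<close> lists elements of \<open>D\<close> that witness the
      promises of \<open>c\<close>; by the common length \<open>n\<close>, these lists can be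
      compared entry by entry.\<close>
    have "\<forall>c\<in>S. \<exists>xs. xs \<in> lists D \<and> length xs = n \<and>
        (\<forall>p v. (p, v) \<in> snd c \<longrightarrow> (\<exists>i<n. xs ! i \<le> p - cover (fst c) v))"
    proof
      fix c assume c: "c \<in> S"
      have "finite (snd c)" using c S(3) conds_finite by blast
      then obtain rs where rs: "set rs = snd c" "length rs = n"
        using card[OF c] by (metis distinct_card finite_distinct_list)
      have "\<forall>r\<in>snd c. \<exists>x\<in>D. x \<le> fst r - cover (fst c) (snd r)"
      proof
        fix r assume "r \<in> snd c"
        then have "fst r - cover (fst c) (snd r) \<noteq> bot"
          using c S(3) conds_promise[of c "fst r" "snd r"] by auto
        then show "\<exists>x\<in>D. x \<le> fst r - cover (fst c) (snd r)" by (rule dense_D)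
      qed
      then obtain g where g: "\<forall>r\<in>snd c. g r \<in> D \<and> g r \<le> fst r - cover (fst c) (snd r)" by metis
      have prom: "\<exists>i<n. map g rs ! i \<le> p - cover (fst c) v" if pv: "(p, v) \<in> snd c" for p v
      proof -
        obtain i where "i < n" "rs ! i = (p, v)" using pv rs by (metis in_set_conv_nth)
        then show ?thesis using bspec[OF g pv] rs(2) by (intro exI[of _ i]) simp
      qed
      have "map g rs \<in> lists D" "length (map g rs) = n" using g rs by auto
      then show "\<exists>xs. xs \<in> lists D \<and> length xs = n \<and>
          (\<forall>p v. (p, v) \<in> snd c \<longrightarrow> (\<exists>i<n. xs ! i \<le> p - cover (fst c) v))"
        using prom by blast
    qed
    from bchoice[OF this] obtain xs where "\<forall>c\<in>S. xs c \<in> lists D \<and> length (xs c) = n \<and>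
        (\<forall>p v. (p, v) \<in> snd c \<longrightarrow> (\<exists>i<n. xs c ! i \<le> p - cover (fst c) v))" ..
    then have xs: "\<And>c. c \<in> S \<Longrightarrow> xs c \<in> lists D" "\<And>c. c \<in> S \<Longrightarrow> length (xs c) = n"
        "\<And>c p v. c \<in> S \<Longrightarrow> (p, v) \<in> snd c \<Longrightarrow> \<exists>i<n. xs c ! i \<le> p - cover (fst c) v"
      by blast+
    have nthD: "ys ! i \<in> D" if "ys \<in> lists D" "i < length ys" for ys i
      using that by (auto simp: in_lists_conv_set)
    have avoid: "countable {c \<in> S. \<exists>i<length ys. ys ! i - cover (fst c) w = bot}"
      if ys: "ys \<in> lists D" for ys
    proof -
      \<comment> \<open>\<open>K\<close> contains all stages up to the index of any entry of
        \<open>ys\<close>. A condition with no coordinate in \<open>K\<close> off the root uses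
        later pieces there, and by \<open>d_diff_Sup_neq_bot\<close> these cannot cover the
        entry.\<close>
      define K where "K = (\<Union>i<length ys. {..inv d (ys ! i)})"
      have "countable K" unfolding K_def
        by (intro countable_UN countable_atMost_omega1 countable_finite) simp
      have "ys ! i - cover (fst c) w \<noteq> bot"
        if c: "c \<in> S" "(fst ` fst c - w) \<inter> K = {}" and i: "i < length ys" for c i
      proof -
        have "d (inv d (ys ! i)) - Sup {x. \<exists>\<alpha> j. (\<alpha>, j, x) \<in> fst c \<and> \<alpha> \<notin> w} \<noteq> bot"
        proof (rule d_diff_Sup_neq_bot)
          have "{x. \<exists>\<alpha> j. (\<alpha>, j, x) \<in> fst c \<and> \<alpha> \<notin> w} \<subseteq> (snd \<circ> snd) ` fst c" by force
          moreover have "finite (fst c)" using c(1) S(3) conds_finite by blast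
          ultimately show "finite {x. \<exists>\<alpha> j. (\<alpha>, j, x) \<in> fst c \<and> \<alpha> \<notin> w}"
            using finite_subset by blast
          show "{x. \<exists>\<alpha> j. (\<alpha>, j, x) \<in> fst c \<and> \<alpha> \<notin> w} \<subseteq> (\<Union>\<alpha>\<in>{inv d (ys ! i)..}. I \<alpha>)"
          proof clarify
            fix x \<alpha> j assume x: "(\<alpha>, j, x) \<in> fst c" "\<alpha> \<notin> w"
            have "\<alpha> \<in> fst ` fst c" using x(1) by force
            then have "\<not> \<alpha> \<le> inv d (ys ! i)" using c(2) i x(2) unfolding K_def by blast
            moreover have "x \<in> I \<alpha>" using x(1) c(1) S(3) conds_piece by blast
            ultimately show "x \<in> (\<Union>\<alpha>\<in>{inv d (ys ! i)..}. I \<alpha>)" by (auto simp: not_le less_imp_le)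
          qed
        qed
        moreover have "d (inv d (ys ! i)) = ys ! i"
          using nthD[OF ys i] range_d by (simp add: f_inv_into_f)
        ultimately show ?thesis by (simp add: cover_def)
      qed
      then have "{c \<in> S. \<exists>i<length ys. ys ! i - cover (fst c) w = bot} \<subseteq>
          {c \<in> S. (fst ` fst c - w) \<inter> K \<noteq> {}}" by blast
      then show ?thesis by (rule countable_subset[OF _ rare[OF \<open>countable K\<close>]])
    qed
    obtain q where q: "q \<in> lists D"
        "\<forall>q'\<in>lists D. list_le (\<le>) q' q \<longrightarrow>
          uncountable {c \<in> S. compatible (lists D) (list_le (\<le>)) q' (xs c)}"
      using ccc_poset_often_compatible[OF poset_on_lists[OF poset_D] ccc_lists_D xs(1) S(1)] ..
    have D_ne: "d undefined \<in> D" by (rule d_in_D)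
    \<comment> \<open>\<open>q\<close> may be shorter than \<open>n\<close>; after padding, every
      entry of a list \<open>xs c'\<close> faces an entry of \<open>q1\<close>. Any filler from
      \<open>D\<close> will do, since \<open>q1\<close> only has to extend \<open>q\<close>.\<close>
    define q1 where "q1 = q @ replicate n (d undefined)"
    have q1: "q1 \<in> lists D" "n \<le> length q1" "list_le (\<le>) q1 q"
      using q(1) D_ne by (auto simp: q1_def list_le_def nth_append)
    have "S - {c \<in> S. \<exists>i<length q1. q1 ! i - cover (fst c) w = bot} \<noteq> {}"
      using uncountable_minus_countable[OF S(1) avoid[OF q1(1)]] by (metis countable_empty)
    then obtain c where c: "c \<in> S" "\<And>i. i < length q1 \<Longrightarrow> q1 ! i - cover (fst c) w \<noteq> bot" by blast
    have "\<forall>i<length q1. \<exists>x\<in>D. x \<le> q1 ! i - cover (fst c) w" using c(2) dense_D by blast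
    then obtain g where g: "\<And>i. i < length q1 \<Longrightarrow> g i \<in> D \<and> g i \<le> q1 ! i - cover (fst c) w" by metis
    define q2 where "q2 = map g [0..<length q1]"
    have q2: "q2 \<in> lists D" using g by (auto simp: q2_def)
    have "q2 ! i \<le> q1 ! i" if "i < length q1" for i
      using g[OF that] that by (auto simp: q2_def diff_eq)
    then have "list_le (\<le>) q2 q1" by (simp add: list_le_def q2_def)
    then have "list_le (\<le>) q2 q"
      using q1(3) unfolding list_le_def by (meson less_le_trans order_trans)
    then have unc: "uncountable {c' \<in> S. compatible (lists D) (list_le (\<le>)) q2 (xs c')}"
      using q(2) q2 by blast
    have cK: "countable (fst ` fst c)" using fin c(1) S(2) by (intro countable_finite) blast
    have "countable ({c} \<union> {c' \<in> S. (fst ` fst c' - w) \<inter> fst ` fst c \<noteq> {}} \<union>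
        {c' \<in> S. \<exists>i<length (xs c). xs c ! i - cover (fst c') w = bot})"
      using rare[OF cK] avoid[OF xs(1)[OF c(1)]] by simp
    from uncountable_minus_countable[OF unc this]
    have "{c' \<in> S. compatible (lists D) (list_le (\<le>)) q2 (xs c')} -
        ({c} \<union> {c' \<in> S. (fst ` fst c' - w) \<inter> fst ` fst c \<noteq> {}} \<union>
        {c' \<in> S. \<exists>i<length (xs c). xs c ! i - cover (fst c') w = bot}) \<noteq> {}"
      by (metis countable_empty)
    then obtain c' where c': "c' \<in> S" "compatible (lists D) (list_le (\<le>)) q2 (xs c')" "c' \<noteq> c"
        "(fst ` fst c' - w) \<inter> fst ` fst c = {}"
        "\<And>i. i < length (xs c) \<Longrightarrow> xs c ! i - cover (fst c') w \<noteq> bot" by blast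
    have "compatible conds refines (fst c, snd c) (fst c', snd c')"
    proof (rule compatible_condsI)
      show "t \<in> fst c \<longleftrightarrow> t \<in> fst c'" if "fst t \<in> w" for t
        using root[OF c(1) c'(1)] that by blast
      show "fst ` fst c \<inter> fst ` fst c' \<subseteq> w" using c'(4) by blast
    next
      fix p v assume "(p, v) \<in> snd c"
      then obtain i where i: "i < n" "xs c ! i \<le> p - cover (fst c) v" using xs(3) c(1) by blast
      have "xs c ! i - cover (fst c') w \<le> p - cover (fst c) v - cover (fst c') w"
        unfolding diff_eq[of _ "cover (fst c') w"] by (rule inf_mono[OF i(2) order_refl])
      then show "p - cover (fst c) v - cover (fst c') w \<noteq> bot"
        using c'(5)[of i] i(1) xs(2)[OF c(1)] by (metis bot_unique)
    next
      fix p v assume "(p, v) \<in> snd c'"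
      then obtain i where i: "i < n" "xs c' ! i \<le> p - cover (fst c') v" using xs(3) c'(1) by blast
      obtain rs where rs: "rs \<in> lists D" "list_le (\<le>) rs q2" "list_le (\<le>) rs (xs c')"
        using c'(2) by (auto simp: compatible_def)
      have len: "i < length q2" "i < length (xs c')" "i < length rs"
        using i(1) q1(2) rs(2) xs(2)[OF c'(1)] by (auto simp: list_le_def q2_def)
      then have "rs ! i \<le> q2 ! i" "rs ! i \<le> xs c' ! i" using rs by (auto simp: list_le_def)
      moreover have "q2 ! i \<le> - cover (fst c) w"
        using g[of i] len(1) by (auto simp: q2_def diff_eq)
      ultimately have "rs ! i \<le> p - cover (fst c') v - cover (fst c) w"
        using i(2) unfolding diff_eq[of _ "cover (fst c) w"] by (meson le_infI order_trans)
      moreover have "rs ! i \<noteq> bot" using nthD[OF rs(1) len(3)] bot_notin_D by metis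
      ultimately show "p - cover (fst c') v - cover (fst c) w \<noteq> bot" by (metis bot_unique)
    next
      show "(fst c, snd c) \<in> conds" using c(1) S(3) by (simp add: subsetD)
      show "(fst c', snd c') \<in> conds" using c'(1) S(3) by (simp add: subsetD)
    qed
    moreover have "c' \<in> A" "c \<in> A" using c(1) c'(1) S(2) by blast+
    ultimately show False using pairwiseD[OF anti _ _ c'(3)[symmetric]] by simp
  qed
qed

end

section \<open>Finite meets of coordinates\<close>

definition meet :: "('k \<Rightarrow> bool \<Rightarrow> 'b::complete_lattice) \<Rightarrow> 'k set \<Rightarrow> ('k \<Rightarrow> bool) \<Rightarrow> 'b" where
  "meet \<beta> w t = (INF \<alpha>\<in>w. \<beta> \<alpha> (t \<alpha>))"

lemma meet_insert: "meet \<beta> (insert \<alpha> w) t = inf (\<beta> \<alpha> (t \<alpha>)) (meet \<beta> w t)"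
  by (simp add: meet_def)

lemma meet_Un: "meet \<beta> (v \<union> w) t = inf (meet \<beta> v t) (meet \<beta> w t)"
  by (simp add: meet_def INF_union)

lemma meet_empty [simp]: "meet \<beta> {} t = top"
  by (simp add: meet_def)

lemma meet_cong: "(\<And>\<alpha>. \<alpha> \<in> w \<Longrightarrow> t \<alpha> = t' \<alpha>) \<Longrightarrow> meet \<beta> w t = meet \<beta> w t'"
  unfolding meet_def by (rule INF_cong) auto

lemma meet_le: "\<alpha> \<in> w \<Longrightarrow> meet \<beta> w t \<le> \<beta> \<alpha> (t \<alpha>)"
  unfolding meet_def by (rule INF_lower)

lemma meet_mono: "(\<And>\<alpha> i. \<beta> \<alpha> i \<le> \<beta>' \<alpha> i) \<Longrightarrow> meet \<beta> w t \<le> meet \<beta>' w t"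
  unfolding meet_def by (rule INF_mono) auto

lemma meet_antimono: "v \<subseteq> w \<Longrightarrow> meet \<beta> w t \<le> meet \<beta> v t"
  unfolding meet_def by (rule INF_superset_mono) auto

lemma neq_bot_mono: "x \<noteq> bot \<Longrightarrow> x \<le> y \<Longrightarrow> y \<noteq> (bot :: 'b::order_bot)"
  using bot_unique by blast

text \<open>Treat the coordinates of \<open>v\<close> in turn, passing to the meet with some
  \<open>\<beta> \<alpha> i\<close> when it is nonzero; either alternative persists when
  \<open>q\<close> shrinks.\<close>

lemma ex_deciding:
  fixes \<beta> :: "'k \<Rightarrow> bool \<Rightarrow> 'b::{complete_lattice, boolean_algebra}"
  assumes "finite v" "p \<noteq> bot"
  shows "\<exists>q\<le>p. q \<noteq> bot \<and> (\<forall>\<alpha>\<in>v. (\<exists>i. q \<le> \<beta> \<alpha> i) \<or> (\<forall>i. inf q (\<beta> \<alpha> i) = bot))"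
  using assms(1)
proof (induction v rule: finite_induct)
  case empty
  then show ?case using assms(2) by blast
next
  case (insert \<alpha> v)
  then obtain q where q: "q \<le> p" "q \<noteq> bot"
      "\<forall>\<alpha>\<in>v. (\<exists>i. q \<le> \<beta> \<alpha> i) \<or> (\<forall>i. inf q (\<beta> \<alpha> i) = bot)" by blast
  show ?case
  proof (cases "\<forall>i. inf q (\<beta> \<alpha> i) = bot")
    case True
    then show ?thesis using q by (intro exI[of _ q]) simp
  next
    case False
    then obtain i where i: "inf q (\<beta> \<alpha> i) \<noteq> bot" by blast
    have "(\<exists>j. inf q (\<beta> \<alpha> i) \<le> \<beta> \<gamma> j) \<or> (\<forall>j. inf (inf q (\<beta> \<alpha> i)) (\<beta> \<gamma> j) = bot)"
      if "\<gamma> \<in> v" for \<gamma>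
      using bspec[OF q(3) that]
    proof
      assume "\<exists>j. q \<le> \<beta> \<gamma> j"
      then show ?thesis using le_infI1 by blast
    next
      assume *: "\<forall>j. inf q (\<beta> \<gamma> j) = bot"
      have "inf (inf q (\<beta> \<alpha> i)) (\<beta> \<gamma> j) = inf (inf q (\<beta> \<gamma> j)) (\<beta> \<alpha> i)" for j
        by (simp add: inf_assoc inf_commute inf_left_commute)
      then show ?thesis using * by simp
    qed
    moreover have "\<exists>j. inf q (\<beta> \<alpha> i) \<le> \<beta> \<alpha> j" by (rule exI[of _ i]) simp
    moreover have "inf q (\<beta> \<alpha> i) \<le> p" using q(1) by (rule le_infI1)
    ultimately show ?thesis using i by (intro exI[of _ "inf q (\<beta> \<alpha> i)"]) auto
  qed
qed

section \<open>Density arguments and the generic coordinates\<close>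

context cohen_poset
begin

lemma val_insert:
  "val (insert (\<alpha>, i, y) b) \<gamma> j = (if \<gamma> = \<alpha> \<and> j = i then sup y (val b \<gamma> j) else val b \<gamma> j)"
proof -
  have "{x. (\<gamma>, j, x) \<in> insert (\<alpha>, i, y) b} =
      (if \<gamma> = \<alpha> \<and> j = i then insert y {x. (\<gamma>, j, x) \<in> b} else {x. (\<gamma>, j, x) \<in> b})" by auto
  then show ?thesis by (simp add: val_def)
qed

lemma cover_insert: "cover (insert (\<alpha>, i, y) b) v \<le> sup y (cover b v)"
  unfolding cover_def[of "insert _ _"] using le_supI2 Sup_upper
  by (intro Sup_least) (auto simp: cover_def intro: le_supI2 Sup_upper)

text \<open>A new piece must meet what is left of \<open>p\<close>, spare the remainder of every
  promise in \<open>R\<close>, and be disjoint from what is already decided at its coordinate;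
  \<open>ex_piece\<close> gives the first two, subtraction the third.\<close>

lemma ex_extension:
  assumes b: "(b, R) \<in> conds" and w: "finite w" and p: "p \<noteq> bot"
    and undecided: "\<forall>\<alpha>\<in>w. \<forall>i. inf p (val b \<alpha> i) = bot"
  shows "\<exists>b'. b \<subseteq> b' \<and> (b', R) \<in> conds \<and> fst ` (b' - b) \<subseteq> w \<and> inf p (meet (val b') w t) \<noteq> bot"
  using w undecided
proof (induction w rule: finite_induct)
  case empty
  show ?case using b p by (intro exI[of _ b]) simp
next
  case (insert \<alpha> w)
  then obtain b' where b': "b \<subseteq> b'" "(b', R) \<in> conds" "fst ` (b' - b) \<subseteq> w"
      "inf p (meet (val b') w t) \<noteq> bot" by auto
  define r where "r = inf p (meet (val b') w t)"
  define z where "z = sup (val b' \<alpha> True) (val b' \<alpha> False)"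
  have same: "val b' \<alpha> i = val b \<alpha> i" for i
  proof -
    have "{x. (\<alpha>, i, x) \<in> b'} = {x. (\<alpha>, i, x) \<in> b}" using b'(1,3) insert.hyps(2) by force
    then show ?thesis by (simp add: val_def)
  qed
  have "inf p z = bot" unfolding z_def same using insert.prems by (simp add: inf_sup_distrib1)
  then have rz: "r \<le> - z" by (simp add: r_def inf_shunt le_infI1)
  let ?A = "(\<lambda>(p, v). p - cover b' v) ` R"
  have "finite ?A" using conds_finite(2)[OF b'(2)] by simp
  moreover have "bot \<notin> ?A" using conds_promise[OF b'(2)] by force
  ultimately obtain x where x: "x \<in> I \<alpha>" "inf r x \<noteq> bot" "\<forall>a\<in>?A. a - x \<noteq> bot"
    using ex_piece[of r ?A \<alpha>] b'(4) by (auto simp only: r_def)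
  \<comment> \<open>\<open>r\<close> is disjoint from the part \<open>z\<close> already decided at
    \<open>\<alpha>\<close>, so subtracting \<open>z\<close> costs nothing below
    \<open>r\<close>.\<close>
  define y where "y = x - z"
  have yI: "y \<in> I \<alpha>"
    unfolding y_def z_def using x(1) val_in_I[OF b'(2)] by (intro diff_in_I sup_in_I)
  let ?b = "insert (\<alpha>, t \<alpha>, y) b'"
  have disj: "inf (val ?b \<gamma> True) (val ?b \<gamma> False) = bot" for \<gamma>
  proof (cases "\<gamma> = \<alpha>")
    case True
    have "y \<le> - z" by (simp add: y_def diff_eq)
    then have "inf y (val b' \<alpha> i) = bot" for i
      unfolding z_def inf_shunt by (cases i) (simp_all add: compl_sup)
    moreover from this have "inf (val b' \<alpha> i) y = bot" for i by (simp add: inf_commute)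
    ultimately show ?thesis
      using True conds_disjoint[OF b'(2), of \<alpha>]
      by (cases "t \<alpha>") (simp_all add: val_insert inf_sup_distrib1 inf_sup_distrib2)
  qed (use conds_disjoint[OF b'(2), of \<gamma>] in \<open>simp add: val_insert\<close>)
  have prom: "q - cover ?b v \<noteq> bot" if "(q, v) \<in> R" for q v
  proof -
    have "q - cover b' v - x \<noteq> bot" using x(3) that by force
    then have "q - sup (cover b' v) x \<noteq> bot" by (simp add: diff_eq inf_assoc)
    moreover have "cover ?b v \<le> sup (cover b' v) x"
      by (rule order_trans[OF cover_insert]) (simp add: y_def diff_eq le_supI2 le_infI1)
    ultimately show ?thesis by (rule diff_mono_neq_bot)
  qed
  have "(?b, R) \<in> conds"
    using b'(2) yI disj prom unfolding conds_def by auto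
  moreover have "inf p (meet (val ?b) (insert \<alpha> w) t) \<noteq> bot"
  proof (rule neq_bot_mono)
    have "inf r y = inf r x" unfolding y_def diff_eq using rz
      by (metis inf.absorb1 inf_assoc inf_commute)
    then show "inf r y \<noteq> bot" using x(2) by simp
    have "r \<le> meet (val ?b) w t"
      unfolding r_def by (intro le_infI2 meet_mono val_mono) blast
    moreover have "r \<le> p" by (simp add: r_def)
    ultimately show "inf r y \<le> inf p (meet (val ?b) (insert \<alpha> w) t)"
      by (simp add: meet_insert val_insert le_infI1 le_infI2 le_supI1)
  qed
  moreover have "b \<subseteq> ?b" "fst ` (?b - b) \<subseteq> insert \<alpha> w" using b'(1,3) by auto
  ultimately show ?case by blast
qed

text \<open>The source of promises. Once \<open>r\<close> decides every coordinate in the support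
  \<open>v\<close> of the condition, there are no pieces outside \<open>v\<close>, so the promise
  \<open>(r, v)\<close> can be added for free.\<close>

lemma dense_decided:
  assumes p: "p \<in> D"
  shows "dense_in conds refines
    {c \<in> conds. \<exists>r v t. (r, v) \<in> snd c \<and> r \<le> p \<and> finite v \<and> r \<le> meet (val (fst c)) v t}"
    (is "dense_in conds refines ?E")
  unfolding dense_in_def
proof (intro conjI ballI)
  fix c assume c: "c \<in> conds"
  obtain b R where eq: "c = (b, R)" by (cases c)
  define v where "v = fst ` b"
  have fv: "finite v" using conds_finite(1)[OF c] by (simp add: v_def eq)
  have "p \<noteq> bot" using p bot_notin_D by blast
  from ex_deciding[OF fv this, of "val b"]
  obtain q where q: "q \<le> p" "q \<noteq> bot"
      "\<forall>\<alpha>\<in>v. (\<exists>i. q \<le> val b \<alpha> i) \<or> (\<forall>i. inf q (val b \<alpha> i) = bot)"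
    by (elim exE conjE) (rule that)
  define w where "w = {\<alpha> \<in> v. \<forall>i. inf q (val b \<alpha> i) = bot}"
  have "\<forall>\<alpha>\<in>v - w. \<exists>i. q \<le> val b \<alpha> i" using q(3) by (auto simp: w_def)
  from bchoice[OF this] obtain t where t: "\<forall>\<alpha>\<in>v - w. q \<le> val b \<alpha> (t \<alpha>)" ..
  have fw: "finite w" using fv by (simp add: w_def)
  have und: "\<forall>\<alpha>\<in>w. \<forall>i. inf q (val b \<alpha> i) = bot" by (simp add: w_def)
  obtain b' where b': "b \<subseteq> b'" "(b', R) \<in> conds" "fst ` (b' - b) \<subseteq> w"
      "inf q (meet (val b') w t) \<noteq> bot"
    using ex_extension[OF c[unfolded eq] fw q(2) und, of t] by (elim exE conjE) (rule that)
  obtain r where r: "r \<in> D" "r \<le> inf q (meet (val b') w t)" using dense_D[OF b'(4)] by blast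
  have rq: "r \<le> q" using r(2) by simp
  have "r \<le> val b' \<alpha> (t \<alpha>)" if \<alpha>: "\<alpha> \<in> v" for \<alpha>
  proof (cases "\<alpha> \<in> w")
    case True
    then show ?thesis using r(2) meet_le[of \<alpha> w "val b'" t] by (meson le_infE order_trans)
  next
    case False
    then have "q \<le> val b \<alpha> (t \<alpha>)" using t \<alpha> by blast
    then show ?thesis using rq val_mono[OF b'(1)] by (meson order_trans)
  qed
  then have dec: "r \<le> meet (val b') v t" unfolding meet_def by (rule INF_greatest)
  have "{x. \<exists>\<alpha> i. (\<alpha>, i, x) \<in> b' \<and> \<alpha> \<notin> v} = {}"
    using b'(3) by (force simp: v_def w_def)
  then have "r - cover b' v \<noteq> bot"
    using r(1) bot_notin_D by (simp only: cover_def Sup_empty) (auto simp: diff_eq)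
  then have "(b', insert (r, v) R) \<in> conds"
    using b'(2) r(1) fv by (auto simp: conds_def Fpow_def)
  moreover have "refines (b', insert (r, v) R) c" using b'(1) by (auto simp: refines_def eq)
  moreover have "r \<le> p" using rq q(1) by (rule order_trans)
  ultimately show "\<exists>c'\<in>?E. refines c' c"
    using dec fv by (intro bexI[of _ "(b', insert (r, v) R)"]) auto
qed auto

text \<open>How a promise is redeemed: \<open>p - cover b v\<close> is undecided at every coordinate
  outside \<open>v\<close>, so \<open>ex_extension\<close> can decide those in \<open>w\<close>
  there as \<open>t\<close> says. The implication keeps the set dense even where the promise is
  inadmissible.\<close>

lemma dense_realised:
  assumes w: "finite w" and vw: "v \<inter> w = {}"
  shows "dense_in conds refines {c \<in> conds. (fst c, insert (p, v) (snd c)) \<in> conds \<longrightarrow>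
    inf p (meet (val (fst c)) w t) \<noteq> bot}"
    (is "dense_in conds refines ?E")
  unfolding dense_in_def
proof (intro conjI ballI)
  fix c assume c: "c \<in> conds"
  obtain b R where eq: "c = (b, R)" by (cases c)
  show "\<exists>c'\<in>?E. refines c' c"
  proof (cases "(b, insert (p, v) R) \<in> conds")
    case True
    have rest: "p - cover b v \<noteq> bot" using conds_promise[OF True, of p v] by simp
    have und: "\<forall>\<alpha>\<in>w. \<forall>i. inf (p - cover b v) (val b \<alpha> i) = bot"
    proof (intro ballI allI)
      fix \<alpha> i assume "\<alpha> \<in> w"
      then have "val b \<alpha> i \<le> cover b v" using vw by (intro val_le_cover) blast
      then have "p - cover b v \<le> - val b \<alpha> i" unfolding diff_eq by (intro le_infI2 compl_mono)
      then show "inf (p - cover b v) (val b \<alpha> i) = bot" by (simp add: inf_shunt)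
    qed
    obtain b' where b': "b \<subseteq> b'" "(b', R) \<in> conds"
        "inf (p - cover b v) (meet (val b') w t) \<noteq> bot"
      using ex_extension[OF c[unfolded eq] w rest und, of t] by (elim exE conjE) (rule that)
    have "inf p (meet (val b') w t) \<noteq> bot"
      by (rule neq_bot_mono[OF b'(3)]) (simp add: diff_eq le_infI1)
    then show ?thesis using b'(1,2) by (intro bexI[of _ "(b', R)"]) (auto simp: refines_def eq)
  next
    case False
    then show ?thesis using c by (intro bexI[of _ c]) (auto simp: refines_def eq)
  qed
qed auto

lemma ex_generic_coordinates:
  "\<exists>\<beta> :: omega1 \<Rightarrow> bool \<Rightarrow> 'b. (\<forall>\<alpha>. inf (\<beta> \<alpha> True) (\<beta> \<alpha> False) = bot) \<and>
    (\<forall>w t. finite w \<longrightarrow> meet \<beta> w t \<noteq> bot) \<and>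
    (\<forall>p. p \<noteq> bot \<longrightarrow> (\<exists>r v t. r \<noteq> bot \<and> r \<le> p \<and> finite v \<and> r \<le> meet \<beta> v t \<and>
      (\<forall>w t'. finite w \<and> v \<inter> w = {} \<longrightarrow> inf r (meet \<beta> w t') \<noteq> bot)))"
proof -
  define E where "E p = {c \<in> conds. \<exists>r v t. (r, v) \<in> snd c \<and> r \<le> p \<and> finite v \<and> r \<le> meet (val (fst c)) v t}" for p
  \<comment> \<open>The assignment is encoded by the finite set \<open>u\<close> of coordinates sent
    to \<open>True\<close>: there are only \<open>aleph1\<close> many of these, but more functions
    on \<open>omega1\<close>.\<close>
  define E' where "E' = (\<lambda>(p, v, w, u). {c \<in> conds. (fst c, insert (p, v) (snd c)) \<in> conds \<longrightarrow>
    inf p (meet (val (fst c)) w (\<lambda>\<alpha>. \<alpha> \<in> u)) \<noteq> bot})"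
  define J where "J = {(p, v, w, u). p \<in> D \<and> v \<in> Fpow (UNIV :: omega1 set) \<and> w \<in> Fpow (UNIV :: omega1 set) \<and>
    u \<in> Fpow (UNIV :: omega1 set) \<and> v \<inter> w = {}}"
  have "small (D \<times> Fpow (UNIV :: omega1 set) \<times> Fpow (UNIV :: omega1 set) \<times> Fpow (UNIV :: omega1 set))"
    by (intro small_Times small_D small_Fpow small_omega1)
  then have "small J" by (rule small_subset[rotated]) (auto simp: J_def)
  have sm: "small (E ` D \<union> E' ` J)"
  proof -
    have "small (\<Union>x\<in>{E ` D, E' ` J}. x)"
    proof (rule small_UN)
      show "small x" if "x \<in> {E ` D, E' ` J}" for x
        using that small_image[OF small_D, of E] small_image[OF \<open>small J\<close>, of E'] by auto
    qed (rule small_countable, simp)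
    then show ?thesis by simp
  qed
  have dense: "\<forall>X\<in>E ` D \<union> E' ` J. dense_in conds refines X"
    using dense_decided dense_realised by (auto simp: E_def E'_def J_def Fpow_def)
  define p\<^sub>0 where "p\<^sub>0 = d undefined"
  have p0: "p\<^sub>0 \<in> D" by (simp add: p\<^sub>0_def d_in_D)
  \<comment> \<open>The starting condition promises \<open>p\<^sub>0\<close> with no exceptional
    coordinates; redeeming this makes every finite meet nonzero.\<close>
  have c0: "({}, {(p\<^sub>0, {})}) \<in> conds"
  proof -
    have "p\<^sub>0 - cover {} {} \<noteq> bot" using p0 bot_notin_D by (auto simp: cover_def diff_eq)
    then show ?thesis using p0 by (simp add: conds_def val_def Fpow_def)
  qed
  obtain G where G: "G \<subseteq> conds" "({}, {(p\<^sub>0, {})}) \<in> G"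
      "\<forall>p\<in>G. \<forall>q\<in>G. \<exists>r\<in>G. refines r p \<and> refines r q" "\<forall>X\<in>E ` D \<union> E' ` J. G \<inter> X \<noteq> {}"
    using MA_generic[OF universe MA poset_conds ccc_conds small_conds c0 sm dense]
    by (elim exE conjE) (rule that)
  define \<beta> where "\<beta> \<alpha> i = Sup {x. \<exists>c\<in>G. (\<alpha>, i, x) \<in> fst c}" for \<alpha> i
  have val_le: "val (fst c) \<alpha> i \<le> \<beta> \<alpha> i" if "c \<in> G" for c \<alpha> i
    unfolding val_def \<beta>_def using that by (intro Sup_subset_mono) blast
  have disj: "inf (\<beta> \<alpha> True) (\<beta> \<alpha> False) = bot" for \<alpha>
  proof (rule ccontr)
    assume *: "inf (\<beta> \<alpha> True) (\<beta> \<alpha> False) \<noteq> bot"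
    from inf_Sup_neq_bot[OF *[unfolded \<beta>_def[of \<alpha> False]]]
    obtain y c' where y: "c' \<in> G" "(\<alpha>, False, y) \<in> fst c'" "inf (\<beta> \<alpha> True) y \<noteq> bot" by blast
    then have "inf y (\<beta> \<alpha> True) \<noteq> bot" by (simp add: inf_commute)
    from inf_Sup_neq_bot[OF this[unfolded \<beta>_def[of \<alpha> True]]]
    obtain x c where x: "c \<in> G" "(\<alpha>, True, x) \<in> fst c" "inf y x \<noteq> bot" by blast
    obtain e where e: "e \<in> G" "refines e c" "refines e c'" using G(3) x(1) y(1) by blast
    then have "x \<le> val (fst e) \<alpha> True" "y \<le> val (fst e) \<alpha> False"
      using x(2) y(2) unfolding val_def refines_def by (auto intro: Sup_upper)
    then have "inf y x \<le> inf (val (fst e) \<alpha> True) (val (fst e) \<alpha> False)"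
      by (simp add: le_infI1 le_infI2)
    also have "\<dots> = bot" using e(1) G(1) conds_disjoint by blast
    finally show False using x(3) by (simp add: bot_unique)
  qed
  have promise: "inf p (meet \<beta> w t) \<noteq> bot"
    if pv: "c \<in> G" "(p, v) \<in> snd c" and w: "finite w" "v \<inter> w = {}" for p v w t c
  proof -
    have "c \<in> conds" using pv(1) G(1) by blast
    then have "p \<in> D" "v \<in> Fpow UNIV" using pv(2) by (auto simp: conds_def)
    then have "(p, v, w, {\<alpha> \<in> w. t \<alpha>}) \<in> J" using w by (auto simp: J_def Fpow_def)
    then obtain c' where c': "c' \<in> G" "c' \<in> E' (p, v, w, {\<alpha> \<in> w. t \<alpha>})" using G(4) by blast
    obtain e where e: "e \<in> G" "refines e c" "refines e c'" using G(3) pv(1) c'(1) by blast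
    have "e \<in> conds" using e(1) G(1) by blast
    then have "(fst c', insert (p, v) (snd c')) \<in> conds"
      by (rule conds_hereditary) (use e(2,3) pv(2) in \<open>auto simp: refines_def\<close>)
    then have "inf p (meet (val (fst c')) w (\<lambda>\<alpha>. \<alpha> \<in> {\<alpha> \<in> w. t \<alpha>})) \<noteq> bot"
      using c'(2) by (simp add: E'_def)
    moreover have "meet (val (fst c')) w (\<lambda>\<alpha>. \<alpha> \<in> {\<alpha> \<in> w. t \<alpha>}) = meet (val (fst c')) w t"
      by (rule meet_cong) simp
    ultimately have "inf p (meet (val (fst c')) w t) \<noteq> bot" by simp
    then show ?thesis
      by (rule neq_bot_mono) (intro inf_mono order_refl meet_mono val_le[OF c'(1)])
  qed
  have "meet \<beta> w t \<noteq> bot" if "finite w" for w t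
    using promise[OF G(2), of p\<^sub>0 "{}" w t] that by auto
  moreover have "\<exists>r v t. r \<noteq> bot \<and> r \<le> p \<and> finite v \<and> r \<le> meet \<beta> v t \<and>
      (\<forall>w t'. finite w \<and> v \<inter> w = {} \<longrightarrow> inf r (meet \<beta> w t') \<noteq> bot)" if p: "p \<noteq> bot" for p
  proof -
    obtain q where q: "q \<in> D" "q \<le> p" using dense_D[OF p] by blast
    then obtain c where c: "c \<in> G" "c \<in> E q" using G(4) by blast
    then obtain r v t where r: "(r, v) \<in> snd c" "r \<le> q" "finite v" "r \<le> meet (val (fst c)) v t"
      by (auto simp: E_def)
    have "c \<in> conds" using c(1) G(1) by blast
    then have "r \<noteq> bot" using conds_promise_in_D r(1) bot_notin_D by blast
    moreover have "r \<le> p" using r(2) q(2) by (rule order_trans)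
    moreover have "r \<le> meet \<beta> v t"
      by (rule order_trans[OF r(4)]) (rule meet_mono, rule val_le[OF c(1)])
    moreover have "\<forall>w t'. finite w \<and> v \<inter> w = {} \<longrightarrow> inf r (meet \<beta> w t') \<noteq> bot"
      using promise[OF c(1) r(1)] by blast
    ultimately show ?thesis using r(3) by blast
  qed
  ultimately show ?thesis using disj by blast
qed

end

section \<open>Complete embeddings of the Cohen algebra\<close>

definition cylinder :: "'k set \<Rightarrow> ('k \<Rightarrow> bool) \<Rightarrow> ('k \<Rightarrow> bool) set" where
  "cylinder w t = {g. \<forall>\<alpha>\<in>w. g \<alpha> = t \<alpha>}"

lemma cylinder_self: "t \<in> cylinder w t"
  by (simp add: cylinder_def)

lemma open_cylinder:
  assumes "finite w"
  shows "open (cylinder w t)"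
proof -
  have coord: "open {g :: 'k \<Rightarrow> bool. g \<alpha> = i}" for \<alpha> i
  proof -
    have "open ((\<lambda>g :: 'k \<Rightarrow> bool. g \<alpha>) -` {i})"
      by (rule open_vimage) (simp_all add: open_discrete continuous_on_product_coordinates)
    then show ?thesis by (simp add: vimage_def)
  qed
  have "cylinder w t = (\<Inter>\<alpha>\<in>w. {g. g \<alpha> = t \<alpha>})" by (auto simp: cylinder_def)
  moreover have "open (\<Inter>\<alpha>\<in>w. {g. g \<alpha> = t \<alpha>})"
    by (rule open_INT[OF assms]) (rule ballI, rule coord)
  ultimately show ?thesis by (simp only:)
qed

lemma ex_cylinder_subset:
  assumes "open U" "g \<in> U"
  shows "\<exists>w. finite w \<and> cylinder w g \<subseteq> (U :: ('k \<Rightarrow> bool) set)"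
proof -
  have "openin (product_topology (\<lambda>i. euclidean) UNIV) U"
    using assms(1) by (simp add: open_fun_def)
  from product_topology_open_contains_basis[OF this assms(2)]
  obtain X where X: "g \<in> Pi\<^sub>E UNIV X" "finite {i. X i \<noteq> UNIV}" "Pi\<^sub>E UNIV X \<subseteq> U"
    by auto
  have "cylinder {i. X i \<noteq> UNIV} g \<subseteq> Pi\<^sub>E UNIV X"
  proof
    fix h assume h: "h \<in> cylinder {i. X i \<noteq> UNIV} g"
    have "h i \<in> X i" for i
    proof (cases "X i = UNIV")
      case False
      then have "h i = g i" using h by (simp add: cylinder_def)
      then show ?thesis using X(1) by (auto simp: PiE_iff)
    qed simp
    then show "h \<in> Pi\<^sub>E UNIV X" by (simp add: PiE_iff)
  qed
  then show ?thesis using X(2,3) by blast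
qed

text \<open>\<open>ex_reduction\<close> is what makes the induced map complete. In particular it
  forces \<open>\<beta> \<alpha> True\<close> and \<open>\<beta> \<alpha> False\<close> to join to
  \<open>top\<close>: a reduction of an element disjoint from both could neither decide
  \<open>\<alpha>\<close> nor leave it free.\<close>

locale generic_coordinates =
  fixes \<beta> :: "'k \<Rightarrow> bool \<Rightarrow> 'b::{complete_lattice, boolean_algebra}"
  assumes disjoint: "inf (\<beta> \<alpha> True) (\<beta> \<alpha> False) = bot"
    and meet_neq_bot: "finite w \<Longrightarrow> meet \<beta> w t \<noteq> bot"
    and ex_reduction: "p \<noteq> bot \<Longrightarrow> \<exists>r v t. r \<noteq> bot \<and> r \<le> p \<and> finite v \<and> r \<le> meet \<beta> v t \<and>
      (\<forall>w t'. finite w \<and> v \<inter> w = {} \<longrightarrow> inf r (meet \<beta> w t') \<noteq> bot)"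
begin

definition join :: "('k \<Rightarrow> bool) set \<Rightarrow> 'b" where
  "join S = Sup {meet \<beta> w t | w t. finite w \<and> cylinder w t \<subseteq> S}"

lemma meet_le_join: "finite w \<Longrightarrow> cylinder w t \<subseteq> S \<Longrightarrow> meet \<beta> w t \<le> join S"
  unfolding join_def by (rule Sup_upper) blast

lemma join_mono: "S \<subseteq> T \<Longrightarrow> join S \<le> join T"
  unfolding join_def by (rule Sup_subset_mono) blast

lemma join_empty: "join {} = bot"
proof -
  have "{meet \<beta> w t | w t. finite w \<and> cylinder w t \<subseteq> {}} = {}" using cylinder_self by blast
  then show ?thesis by (simp only: join_def Sup_empty)
qed

lemma join_UNIV: "join UNIV = top"
  using meet_le_join[of "{}" _ UNIV] by (simp add: top_unique)

lemma inf_join_neq_bot: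
  assumes "inf p (join S) \<noteq> bot"
  obtains w t where "finite w" "cylinder w t \<subseteq> S" "inf p (meet \<beta> w t) \<noteq> bot"
  using inf_Sup_neq_bot[OF assms[unfolded join_def]] by blast

lemma agree:
  assumes "r \<noteq> bot" "r \<le> meet \<beta> v t" "r \<le> meet \<beta> w t'" "\<alpha> \<in> v" "\<alpha> \<in> w"
  shows "t \<alpha> = t' \<alpha>"
proof (rule ccontr)
  assume ne: "t \<alpha> \<noteq> t' \<alpha>"
  have "r \<le> \<beta> \<alpha> (t \<alpha>)" "r \<le> \<beta> \<alpha> (t' \<alpha>)"
    using assms meet_le[of \<alpha> v \<beta> t] meet_le[of \<alpha> w \<beta> t'] by (auto intro: order_trans)
  then have "r \<le> inf (\<beta> \<alpha> True) (\<beta> \<alpha> False)" using ne by (cases "t \<alpha>") auto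
  then show False using assms(1) by (simp only: disjoint bot_unique)
qed

text \<open>Below any element of the left-hand side, a reduction leaves room for a cylinder inside
  some member of \<open>\<U>\<close>: this is where predensity is transferred to the target algebra.\<close>

lemma join_le_Sup:
  assumes op: "\<And>U. U \<in> \<U> \<Longrightarrow> open U" and W: "W \<subseteq> closure (\<Union>\<U>)"
  shows "join W \<le> Sup (join ` \<U>)"
proof (rule ccontr)
  assume "\<not> join W \<le> Sup (join ` \<U>)"
  define p where "p = join W - Sup (join ` \<U>)"
  have "inf p (join W) = p" by (simp add: p_def diff_eq inf_commute inf_left_commute)
  moreover have "p \<noteq> bot" using \<open>\<not> join W \<le> _\<close> by (simp add: p_def diff_shunt_var)
  ultimately have "inf p (join W) \<noteq> bot" by simp
  then obtain w t where w: "finite w" "cylinder w t \<subseteq> W" "inf p (meet \<beta> w t) \<noteq> bot"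
    by (rule inf_join_neq_bot)
  obtain r v s where r: "r \<noteq> bot" "r \<le> inf p (meet \<beta> w t)" "finite v" "r \<le> meet \<beta> v s"
      "\<forall>w t'. finite w \<and> v \<inter> w = {} \<longrightarrow> inf r (meet \<beta> w t') \<noteq> bot"
    using ex_reduction[OF w(3)] by (elim exE conjE) (rule that)
  \<comment> \<open>\<open>r\<close> is nonzero and below both meets, so \<open>s\<close> and
    \<open>t\<close> agree on common coordinates; thus \<open>g\<close> follows \<open>s\<close> on
    \<open>v\<close> and still lies in \<open>cylinder w t\<close>.\<close>
  define g where "g \<alpha> = (if \<alpha> \<in> v then s \<alpha> else t \<alpha>)" for \<alpha>
  have "s \<alpha> = t \<alpha>" if "\<alpha> \<in> v" "\<alpha> \<in> w" for \<alpha>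
    using agree[OF r(1,4) _ that] r(2) by simp
  then have "g \<in> cylinder w t" by (auto simp: cylinder_def g_def)
  then have "g \<in> closure (\<Union>\<U>)" using w(2) W by blast
  moreover have "open (cylinder v g)" using r(3) by (rule open_cylinder)
  ultimately have "\<Union>\<U> \<inter> cylinder v g \<noteq> {}"
    using cylinder_self[of g v] by (meson closure_iff_nhds_not_empty order_refl)
  then obtain h U where h: "h \<in> cylinder v g" "h \<in> U" "U \<in> \<U>" by blast
  obtain u where u: "finite u" "cylinder u h \<subseteq> U"
    using ex_cylinder_subset[OF op[OF h(3)] h(2)] by blast
  have "meet \<beta> v s = meet \<beta> v h"
    by (rule meet_cong) (use h(1) in \<open>simp add: cylinder_def g_def\<close>)
  \<comment> \<open>The coordinates of \<open>u\<close> in \<open>v\<close> are already decided by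
    \<open>r\<close> in accordance with \<open>h\<close>; the others lie outside \<open>v\<close>,
    where the reduction property applies.\<close>
  then have "inf r (meet \<beta> (u - v) h) \<le> inf (meet \<beta> v h) (meet \<beta> (u - v) h)"
    using r(4) by (simp add: le_infI1)
  also have "\<dots> \<le> meet \<beta> u h" unfolding meet_Un[symmetric] by (rule meet_antimono) blast
  also have "\<dots> \<le> join U" by (rule meet_le_join[OF u])
  also have "\<dots> \<le> Sup (join ` \<U>)" using h(3) by (intro Sup_upper imageI)
  finally have "inf r (meet \<beta> (u - v) h) \<le> Sup (join ` \<U>)" .
  moreover have "inf r (meet \<beta> (u - v) h) \<le> - Sup (join ` \<U>)"
    using r(2) by (intro le_infI1) (simp add: p_def diff_eq)
  ultimately have "inf r (meet \<beta> (u - v) h) \<le> inf (Sup (join ` \<U>)) (- Sup (join ` \<U>))"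
    by (rule le_infI)
  then have "inf r (meet \<beta> (u - v) h) = bot" by (simp only: inf_compl_bot bot_unique)
  moreover have "inf r (meet \<beta> (u - v) h) \<noteq> bot" using r(5) u(1) by blast
  ultimately show False by contradiction
qed

text \<open>A nonzero element below both joins has a nonzero part below the meets of a cylinder
  inside \<open>S\<close> and of one inside \<open>T\<close>; by \<open>agree\<close> the two
  assignments merge, and the merged cylinder lies in both sets.\<close>

lemma join_Int: "join (S \<inter> T) = inf (join S) (join T)"
proof (rule antisym)
  show "join (S \<inter> T) \<le> inf (join S) (join T)" by (intro le_infI join_mono) auto
  show "inf (join S) (join T) \<le> join (S \<inter> T)"
  proof (rule ccontr)
    assume "\<not> inf (join S) (join T) \<le> join (S \<inter> T)"
    define p where "p = inf (join S) (join T) - join (S \<inter> T)"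
    have le: "p \<le> join S" "p \<le> join T" "p \<le> - join (S \<inter> T)" by (auto simp: p_def diff_eq le_infI1)
    have "p \<noteq> bot" using \<open>\<not> inf (join S) (join T) \<le> _\<close> by (simp add: p_def diff_shunt_var)
    then have "inf p (join S) \<noteq> bot" using le(1) by (simp add: inf_absorb1)
    then obtain w t where w: "finite w" "cylinder w t \<subseteq> S" "inf p (meet \<beta> w t) \<noteq> bot"
      by (rule inf_join_neq_bot)
    have "inf (inf p (meet \<beta> w t)) (join T) \<noteq> bot" using le(2) w(3) by (simp add: inf_absorb1 le_infI1)
    then obtain w' t' where w': "finite w'" "cylinder w' t' \<subseteq> T"
        "inf (inf p (meet \<beta> w t)) (meet \<beta> w' t') \<noteq> bot" by (rule inf_join_neq_bot)
    define r where "r = inf (inf p (meet \<beta> w t)) (meet \<beta> w' t')"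
    have r: "r \<noteq> bot" "r \<le> p" "r \<le> meet \<beta> w t" "r \<le> meet \<beta> w' t'"
      using w'(3) by (auto simp: r_def le_infI1)
    define s where "s \<alpha> = (if \<alpha> \<in> w then t \<alpha> else t' \<alpha>)" for \<alpha>
    have s: "s \<alpha> = t' \<alpha>" if "\<alpha> \<in> w'" for \<alpha>
      using agree[OF r(1,3,4)] that by (auto simp: s_def)
    have "meet \<beta> w s = meet \<beta> w t" "meet \<beta> w' s = meet \<beta> w' t'"
      by (rule meet_cong, simp add: s_def) (rule meet_cong, rule s)
    then have "r \<le> meet \<beta> (w \<union> w') s" using r(3,4) by (simp add: meet_Un)
    also have "\<dots> \<le> join (S \<inter> T)"
    proof (rule meet_le_join)
      show "cylinder (w \<union> w') s \<subseteq> S \<inter> T"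
        using w(2) w'(2) s by (auto simp: cylinder_def s_def subset_iff)
    qed (use w(1) w'(1) in simp)
    finally have "r \<le> join (S \<inter> T)" .
    moreover have "r \<le> - join (S \<inter> T)" using r(2) le(3) by (rule order_trans)
    ultimately have "r \<le> inf (join (S \<inter> T)) (- join (S \<inter> T))" by (rule le_infI)
    then show False using r(1) by (simp only: inf_compl_bot bot_unique)
  qed
qed

definition embedding :: "'k cohen_algebra \<Rightarrow> 'b" where
  "embedding U = join (Rep_ro U)"

lemma open_Rep_ro: "open (Rep_ro U)"
  using Rep_ro[of U] by (metis (mono_tags, lifting) mem_Collect_eq open_interior)

lemma embedding_bot: "embedding bot = bot"
  by (simp add: embedding_def bot_regular_open.rep_eq join_empty)

lemma embedding_top: "embedding top = top"
  by (simp add: embedding_def top_regular_open.rep_eq join_UNIV)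

lemma embedding_inf: "embedding (inf U V) = inf (embedding U) (embedding V)"
  by (simp add: embedding_def inf_regular_open.rep_eq join_Int)

text \<open>A supremum of regular open sets exceeds their union by points of its closure;
  \<open>join_le_Sup\<close> shows that these add nothing to the image.\<close>

lemma embedding_Sup: "embedding (Sup \<V>) = Sup (embedding ` \<V>)"
proof (rule antisym)
  have "join (Rep_ro (Sup \<V>)) \<le> Sup (join ` (Rep_ro ` \<V>))"
  proof (rule join_le_Sup)
    show "open U" if "U \<in> Rep_ro ` \<V>" for U using that open_Rep_ro by blast
    show "Rep_ro (Sup \<V>) \<subseteq> closure (\<Union>(Rep_ro ` \<V>))"
      unfolding Sup_regular_open.rep_eq by (rule interior_subset)
  qed
  then show "embedding (Sup \<V>) \<le> Sup (embedding ` \<V>)" by (simp add: embedding_def image_image)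
  show "Sup (embedding ` \<V>) \<le> embedding (Sup \<V>)"
  proof (rule Sup_least, clarify)
    fix V assume "V \<in> \<V>"
    then have "inf V (Sup \<V>) = V" by (intro inf_absorb1 Sup_upper)
    then show "embedding V \<le> embedding (Sup \<V>)" using embedding_inf[of V "Sup \<V>"] by (simp add: inf.orderI)
  qed
qed

lemma embedding_compl: "embedding (- U) = - embedding U"
proof (rule compl_unique[symmetric])
  show "inf (embedding U) (embedding (- U)) = bot"
    by (simp add: embedding_inf[symmetric] embedding_bot)
  have "Sup {U, - U} = top"
    by (rule order.antisym[OF top_greatest]) (metis Sup_upper insertCI sup_compl_top sup_least)
  then show "sup (embedding U) (embedding (- U)) = top"
    using embedding_Sup[of "{U, - U}"] by (simp add: embedding_top)
qed

lemma embedding_sup: "embedding (sup U V) = sup (embedding U) (embedding V)"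
proof -
  have "embedding (- inf (- U) (- V)) = sup (embedding U) (embedding V)"
    unfolding embedding_compl embedding_inf by simp
  then show ?thesis by simp
qed

lemma embedding_eq_bot_imp: "embedding U = bot \<Longrightarrow> U = bot"
proof (rule ccontr)
  assume e: "embedding U = bot" and "U \<noteq> bot"
  then obtain g where "g \<in> Rep_ro U"
    by (metis Rep_ro_inject bot_regular_open.rep_eq equals0I)
  then obtain w where w: "finite w" "cylinder w g \<subseteq> Rep_ro U"
    using ex_cylinder_subset[OF open_Rep_ro] by blast
  then have "meet \<beta> w g \<le> bot" using meet_le_join[OF w] e by (simp add: embedding_def)
  then show False using meet_neq_bot[OF w(1)] by (simp add: bot_unique)
qed

lemma inj_embedding: "inj embedding"
proof (rule injI)
  have "U \<le> V" if "embedding U = embedding V" for U V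
  proof -
    have "embedding (inf U (- V)) = bot" by (simp add: embedding_inf embedding_compl that)
    then have "inf U (- V) = bot" by (rule embedding_eq_bot_imp)
    then show ?thesis by (simp add: inf_shunt)
  qed
  then show "U = V" if "embedding U = embedding V" for U V using that by (metis order.antisym)
qed

lemma complete_embedding_embedding: "complete_embedding embedding"
proof -
  have Sup: "Sup X \<in> range embedding" if "X \<subseteq> range embedding" for X
  proof -
    obtain \<V> where "X = embedding ` \<V>" using \<open>X \<subseteq> range embedding\<close> by (meson subset_imageE)
    then show ?thesis by (metis embedding_Sup rangeI)
  qed
  have compl: "- x \<in> range embedding" if "x \<in> range embedding" for x
    using that by (auto simp: embedding_compl[symmetric])
  have Inf: "Inf X \<in> range embedding" if X: "X \<subseteq> range embedding" for X
  proof -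
    have "Inf X = - Sup (uminus ` X)"
    proof (rule antisym)
      have "Sup (uminus ` X) \<le> - Inf X" by (rule Sup_least) (auto intro: Inf_lower)
      then show "Inf X \<le> - Sup (uminus ` X)" by (metis compl_le_compl_iff double_compl)
      show "- Sup (uminus ` X) \<le> Inf X"
      proof (rule Inf_greatest)
        fix x assume "x \<in> X"
        then have "- x \<le> Sup (uminus ` X)" by (intro Sup_upper) blast
        then show "- Sup (uminus ` X) \<le> x" by (metis compl_le_compl_iff double_compl)
      qed
    qed
    moreover have "uminus ` X \<subseteq> range embedding" using X compl by blast
    ultimately show ?thesis using Sup compl by simp
  qed
  show ?thesis
    unfolding complete_embedding_def boolean_hom_def complete_subalgebra_def
    using embedding_bot embedding_top embedding_compl embedding_inf embedding_sup inj_embedding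
      Sup Inf compl by blast
qed

end

theorem corollary14:
  assumes universe: "aleph1 \<le>o |UNIV :: 'p set|"
    and MA: "MA aleph1 TYPE('p)"
    and ccc: "ccc_algebra TYPE('b::{complete_lattice, boolean_algebra})"
    and density: "algebra_uniform_density TYPE('b) aleph1"
  shows "\<exists>f :: omega1 cohen_algebra \<Rightarrow> 'b. complete_embedding f"
proof -
  obtain D :: "'b set" where D: "dense_in {b. b \<noteq> bot} (\<le>) D" "poset_uniform_density D (\<le>) aleph1"
    using density by (auto simp: algebra_uniform_density_def)
  have card: "|D| =o aleph1" using D(2) by (simp add: poset_uniform_density_def)
  interpret ma_algebra "TYPE('p)" D
  proof
    show "small D" using card ordIso_imp_ordLeq by blast
    show "bot \<notin> D" using D(1) by (auto simp: dense_in_def)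
    show "\<exists>d\<in>D. d \<le> p" if "p \<noteq> bot" for p
      using D(1) that by (auto simp: dense_in_def)
  next
    fix q R assume q: "q \<in> D" and R: "R \<subseteq> D" "countable R"
    have "\<not> dense_below D (\<le>) q R"
      using D(2) q R countable_imp_ordLess_aleph1 unfolding poset_uniform_density_def by blast
    then show "\<exists>r\<in>D. r \<le> q \<and> (\<forall>s\<in>R. \<not> s \<le> r)" by (auto simp: dense_below_def)
  qed (use universe MA ccc D(1) in \<open>auto simp: dense_in_def\<close>)
  \<comment> \<open>The size of \<open>D\<close> rules out the trivial algebra, for which there
    would be nothing to enumerate.\<close>
  have "D \<noteq> {}"
  proof
    assume "D = {}"
    then have "aleph1 \<le>o |{} :: 'b set|" using card ordIso_iff_ordLeq by blast
    moreover have "|{} :: 'b set| <o aleph1" by (rule countable_imp_ordLess_aleph1) simp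
    ultimately show False using not_ordLess_ordLeq by blast
  qed
  then obtain d :: "omega1 \<Rightarrow> 'b" where d: "range d = D"
    by (rule small_ex_enumeration[OF small_D])
  obtain I :: "omega1 \<Rightarrow> 'b set" where I: "\<forall>\<alpha>. coordinate_ideal (residues d I \<alpha>) (I \<alpha>)"
    using ex_coordinate_ideals[of d] ..
  interpret cohen_poset "TYPE('p)" D d I
    by unfold_locales (use d I in auto)
  obtain \<beta> :: "omega1 \<Rightarrow> bool \<Rightarrow> 'b" where \<beta>: "\<forall>\<alpha>. inf (\<beta> \<alpha> True) (\<beta> \<alpha> False) = bot"
    "\<forall>w t. finite w \<longrightarrow> meet \<beta> w t \<noteq> bot"
    "\<forall>p. p \<noteq> bot \<longrightarrow> (\<exists>r v t. r \<noteq> bot \<and> r \<le> p \<and> finite v \<and> r \<le> meet \<beta> v t \<and>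
      (\<forall>w t'. finite w \<and> v \<inter> w = {} \<longrightarrow> inf r (meet \<beta> w t') \<noteq> bot))"
    using ex_generic_coordinates by (elim exE conjE) (rule that)
  interpret generic_coordinates \<beta>
  proof
    show "inf (\<beta> \<alpha> True) (\<beta> \<alpha> False) = bot" for \<alpha> using \<beta>(1) ..
    show "meet \<beta> w t \<noteq> bot" if "finite w" for w t using \<beta>(2) that by simp
    show "\<exists>r v t. r \<noteq> bot \<and> r \<le> p \<and> finite v \<and> r \<le> meet \<beta> v t \<and>
      (\<forall>w t'. finite w \<and> v \<inter> w = {} \<longrightarrow> inf r (meet \<beta> w t') \<noteq> bot)" if "p \<noteq> bot" for p
      using \<beta>(3)[rule_format, OF that] .
  qed
  show ?thesis using complete_embedding_embedding by blast
qed

end
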